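(* Let $\alpha\ge J(K^\star)$, let $\gamma:=\max_{K\in\mathbb{K}_\alpha}\|\mathcal{A}_K\|$, and let $$\psi:=\frac{\sqrt{\|R\|\alpha+\|B\|^2\alpha^2/\mu}}{\sqrt{\mu}\,\sigma_{\min}(R)}+\frac{\|B\|\|A\|\alpha}{\mu\sigma_{\min}(R)}$$ (an upper bound of $\|KC\|$ for $K\in\mathbb{K}_\alpha$). Let $K,K'\in\mathbb{K}_\alpha$ be such that $(1-\delta)K+\delta K'\in\mathbb{K}_\alpha$ for every $\delta\in[0,1]$. Then $$\|\nabla^2J(\mathrm{vec}(K'))-\nabla^2J(\mathrm{vec}(K))\|_F\le M\|K'-K\|_F,$$ where $$M=\frac{4\alpha^2\sqrt{md}}{\mu\sigma_{\min}(Q)}\left(\Big(\zeta_1+\frac{\zeta_2}{2}\Big)\|B\|\|C\|+\zeta_3+\frac{\zeta_4}{2}\right)\|B\|\|C\|,$$ $$\zeta_1=\frac{1}{\sigma_{\min}(Q)}\left(\frac{\alpha}{\mu}\big(1+\|B\|^2\|C\|^2\big)+\|R\|\|C\|^2\right)-1,$$ $$\zeta_2=\frac{2\|C\|}{\sigma_{\min}(Q)}\left(\frac{\alpha\gamma}{\mu}\|B\|+\psi\|R\|\right),$$ $$\zeta_3=\frac{2\|C\|}{\sigma_{\min}(Q)}\left(\frac{\alpha}{\mu}(\zeta_1\gamma+\zeta_2\gamma+\|B\|\|C\|)\|B\|+\|R\|\|C\|\right),$$ $$\zeta_4=\frac{2\|C\|}{\sigma_{\min}(Q)}\left(\frac{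\alpha}{\mu}(\zeta_1\gamma+\|B\|\|C\|)\|B\|+\|R\|\|C\|\right).$$
   Context: Setting (static output feedback, SOF). $A\in\mathbb{R}^{n\times n}$, $B\in\mathbb{R}^{n\times m}$, $C\in\mathbb{R}^{d\times n}$; $(A,B)$ is controllable, $(C,A)$ is observable, and $C$ has linearly independent rows. $Q\in\mathbb{R}^{n\times n}$ and $R\in\mathbb{R}^{m\times m}$ are symmetric positive definite. $\mathcal{D}$ is a probability distribution on $\mathbb{R}^n$ with $X_0:=\mathbb{E}_{x_0\sim\mathcal{D}}[x_0x_0^\top]\succ 0$, and $\mu:=\sigma_{\min}(X_0)>0$. For $K\in\mathbb{R}^{m\times d}$ put $\mathcal{A}_K:=A-BKC$. The set of stabilizing gains is $\mathbb{K}:=\{K\in\mathbb{R}^{m\times d}:\rho(\mathcal{A}_K)<1\}$ ($\rho$ is the spectral radius), assumed nonempty. For $K\in\mathbb{K}$, $$J(K):=\mathbb{E}_{x_0\sim\mathcal{D}}\Big[\sum_{t=0}^\infty x_t^\top(Q+C^\top K^\top RKC)x_t\Big],\quad x_{t+1}=\mathcal{A}_Kx_t .$$ Equivalently $J(K)=\mathrm{Tr}(P_KX_0)$, where $P_K=Q+C^\top K^\top RKC+\mathcal{A}_K^\top P_K\mathcal{A}_K$. $K^\star$ is a global minimizer of $J$ over $\mathbb{K}$, and $\mathbb{K}_\alpha:=\{K\in\mathbb{K}:J(K)\le\alpha\}$. $\nabla^2J(\mathrm{vec}(K))\in\mathbb{R}^{md\times md}$ is the Hessian of $J$ viewed as a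 function of the vectorization $\mathrm{vec}(K)$. $\|\cdot\|$ is the induced 2-norm, $\|\cdot\|_F$ the Frobenius norm, and $\sigma_{\min}$ the minimal singular value. *)

theory Defs
  imports "HOL-Analysis.Analysis" "HOL-Probability.Probability"
begin

section \<open>Matrix norms, singular values and the spectral radius\<close>

definition frobenius_norm :: "real^'n^'m \<Rightarrow> real" where
  "frobenius_norm M = sqrt (\<Sum>i\<in>UNIV. \<Sum>j\<in>UNIV. (M $ i $ j)\<^sup>2)"

lemma frobenius_norm_eq_norm: "frobenius_norm M = norm M"
  by (simp add: frobenius_norm_def norm_vec_def L2_set_def sum_nonneg)

definition norm2 :: "real^'n^'m \<Rightarrow> real" where
  "norm2 M = onorm (\<lambda>x. M *v x)"

definition singular_values :: "real^'n^'n \<Rightarrow> real set" where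
  "singular_values M =
     {s. 0 \<le> s \<and> (\<exists>x. x \<noteq> 0 \<and> (transpose M ** M) *v x = s\<^sup>2 *\<^sub>R x)}"

definition sigma_min :: "real^'n^'n \<Rightarrow> real" where
  "sigma_min M = Min (singular_values M)"

lemma finite_singular_values: "finite (singular_values M)"
proof -
  define N where "N = transpose M ** M"
  define v where "v s = (SOME x. x \<noteq> 0 \<and> N *v x = s\<^sup>2 *\<^sub>R x)" for s :: real
  have v: "v s \<noteq> 0" "N *v v s = s\<^sup>2 *\<^sub>R v s" if "s \<in> singular_values M" for s
    using that someI_ex[of "\<lambda>x. x \<noteq> 0 \<and> N *v x = s\<^sup>2 *\<^sub>R x"]
    by (auto simp: singular_values_def v_def N_def)
  have sym: "(N *v x) \<bullet> y = x \<bullet> (N *v y)" for x y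
    by (metis N_def dot_lmul_matrix matrix_transpose_mul transpose_matrix_vector
        transpose_transpose)
  have orth: "v s \<bullet> v t = 0" if "s \<in> singular_values M" "t \<in> singular_values M" "s \<noteq> t" for s t
  proof -
    have "s\<^sup>2 * (v s \<bullet> v t) = t\<^sup>2 * (v s \<bullet> v t)"
      using sym[of "v s" "v t"] v that by simp
    moreover have "s\<^sup>2 \<noteq> t\<^sup>2"
      using that by (auto simp: singular_values_def power2_eq_iff_nonneg)
    ultimately show ?thesis by simp
  qed
  have inj: "inj_on v (singular_values M)"
    by (rule inj_onI) (metis orth v(1) inner_eq_zero_iff)
  have "pairwise orthogonal (v ` singular_values M)"
    unfolding pairwise_image orthogonal_def pairwise_def using orth by auto
  then have "finite (v ` singular_values M)"
    by (rule pairwise_orthogonal_imp_finite)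
  then show ?thesis using inj by (rule finite_imageD)
qed

text \<open>A real square matrix is regarded as a complex one, so that its non-real eigenvalues count.\<close>

definition complex_eigenvalues :: "real^'n^'n \<Rightarrow> complex set" where
  "complex_eigenvalues M =
     {l. \<exists>v :: complex^'n. v \<noteq> 0 \<and> (\<chi> i j. complex_of_real (M $ i $ j)) *v v = l *s v}"

definition spec_rad :: "real^'n^'n \<Rightarrow> real" where
  "spec_rad M = Max (cmod ` complex_eigenvalues M)"

definition sym_pos_def :: "real^'n^'n \<Rightarrow> bool" where
  "sym_pos_def M \<longleftrightarrow> transpose M = M \<and> (\<forall>x. x \<noteq> 0 \<longrightarrow> x \<bullet> (M *v x) > 0)"

text \<open>Independence of the rows as an indexed family: \<^term>\<open>rows M\<close> is a set, hence blind to
  repeated rows.\<close>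

definition independent_rows :: "real^'n^'m \<Rightarrow> bool" where
  "independent_rows M \<longleftrightarrow>
     (\<forall>c. (\<Sum>i\<in>UNIV. c i *\<^sub>R row i M) = 0 \<longrightarrow> (\<forall>i. c i = 0))"


section \<open>Linear systems with static output feedback\<close>

text \<open>Kalman rank conditions: the matrices \<open>[B, AB, \<dots>, A\<^sup>n\<^sup>-\<^sup>1B]\<close> and
  \<open>[C; CA; \<dots>; CA\<^sup>n\<^sup>-\<^sup>1]\<close> have rank \<open>n\<close>. (The power operator on
  \<^typ>\<open>real^'n^'n\<close> is componentwise, so products are iterated instead.)\<close>

definition controllable :: "real^'n^'n \<Rightarrow> real^'m^'n \<Rightarrow> bool" where
  "controllable A B \<longleftrightarrow>
     dim (\<Union>k<CARD('n). columns (((\<lambda>M. A ** M) ^^ k) B)) = CARD('n)"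

definition observable :: "real^'n^'d \<Rightarrow> real^'n^'n \<Rightarrow> bool" where
  "observable C A \<longleftrightarrow>
     dim (\<Union>k<CARD('n). rows (((\<lambda>M. M ** A) ^^ k) C)) = CARD('n)"

definition closed_loop ::
  "real^'n^'n \<Rightarrow> real^'m^'n \<Rightarrow> real^'n^'d \<Rightarrow> real^'d^'m \<Rightarrow> real^'n^'n" where
  "closed_loop A B C K = A - B ** K ** C"

definition stabilizing ::
  "real^'n^'n \<Rightarrow> real^'m^'n \<Rightarrow> real^'n^'d \<Rightarrow> (real^'d^'m) set" where
  "stabilizing A B C = {K. spec_rad (closed_loop A B C K) < 1}"

definition state ::
  "real^'n^'n \<Rightarrow> real^'m^'n \<Rightarrow> real^'n^'d \<Rightarrow> real^'d^'m \<Rightarrow> real^'n \<Rightarrow> nat \<Rightarrow> real^'n" where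
  "state A B C K x0 t = ((\<lambda>x. closed_loop A B C K *v x) ^^ t) x0"

text \<open>Only the values at stabilizing gains are meaningful.\<close>

definition sof_cost ::
  "real^'n^'n \<Rightarrow> real^'m^'n \<Rightarrow> real^'n^'d \<Rightarrow> real^'n^'n \<Rightarrow> real^'m^'m \<Rightarrow>
     (real^'n) measure \<Rightarrow> real^'d^'m \<Rightarrow> real" where
  "sof_cost A B C Q R D K =
     (\<integral>x0. (\<Sum>t. state A B C K x0 t \<bullet>
        ((Q + transpose C ** transpose K ** R ** K ** C) *v state A B C K x0 t)) \<partial>D)"

definition sof_sublevel ::
  "real^'n^'n \<Rightarrow> real^'m^'n \<Rightarrow> real^'n^'d \<Rightarrow> real^'n^'n \<Rightarrow> real^'m^'m \<Rightarrow>
     (real^'n) measure \<Rightarrow> real \<Rightarrow> (real^'d^'m) set" where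
  "sof_sublevel A B C Q R D \<alpha> = {K \<in> stabilizing A B C. sof_cost A B C Q R D K \<le> \<alpha>}"

text \<open>The Bochner integral of a non-integrable function is zero, so positive definiteness of this
  matrix entails that \<open>D\<close> has finite second moments.\<close>

definition second_moment :: "(real^'n) measure \<Rightarrow> real^'n^'n" where
  "second_moment D = (\<integral>x. (\<chi> i j. x $ i * x $ j) \<partial>D)"


section \<open>Vectorization and the Hessian\<close>

text \<open>The index \<open>(j, i)\<close> of the column-stacking vectorization is the column-major position of the
  entry in row \<open>i\<close> and column \<open>j\<close>.\<close>

definition vectorize :: "real^'d^'m \<Rightarrow> real^('d \<times> 'm)" where
  "vectorize K = (\<chi> p. K $ snd p $ fst p)"

definition unvectorize :: "real^('d \<times> 'm) \<Rightarrow> real^'d^'m" where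
  "unvectorize v = (\<chi> i j. v $ (j, i))"

lemma unvectorize_vectorize [simp]: "unvectorize (vectorize K) = K"
  by (simp add: vectorize_def unvectorize_def vec_eq_iff)

lemma vectorize_unvectorize [simp]: "vectorize (unvectorize v) = v"
  by (simp add: vectorize_def unvectorize_def vec_eq_iff)

definition grad :: "(real^'k \<Rightarrow> real) \<Rightarrow> real^'k \<Rightarrow> real^'k" where
  "grad f x = (\<chi> i. frechet_derivative f (at x) (axis i 1))"

definition hessian :: "(real^'k \<Rightarrow> real) \<Rightarrow> real^'k \<Rightarrow> real^'k^'k" where
  "hessian f x = jacobian (grad f) (at x)"

end

theory Submission
  imports Defs "HOL-Computational_Algebra.Fundamental_Theorem_Algebra"
begin

text \<open>The cost is the pairing of \<open>P\<^sub>K\<close> with the second moment, and \<open>P\<^sub>K\<close> solves the Stein equation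
  \<open>X - A\<^sub>K\<^sup>T X A\<^sub>K = F\<close> with \<open>F = Q + C\<^sup>T K\<^sup>T R K C\<close>. Differentiating, each directional derivative of
  \<open>P\<^sub>K\<close> solves the same equation with a right-hand side built from lower derivatives. If the quadratic
  form of a right-hand side is at most \<open>u\<close> times that of \<open>Q + C\<^sup>T K\<^sup>T R K C\<close>, then the form of its solution
  is at most \<open>u\<close> times that of \<open>P\<^sub>K\<close>; this bounds the first three derivatives relative to \<open>P\<^sub>K\<close>, and
  the mean value theorem on the segment turns the bound on the third one into the Lipschitz bound.

  The constant \<open>\<zeta>\<^sub>4\<close> contains \<open>\<zeta>\<^sub>1\<close> once, although the second derivative in the direction \<open>(Z, Z)\<close> has
  two cross terms in the first derivative. The missing summand is recovered because the first
  derivative is bounded not only by \<open>\<zeta>\<^sub>1\<close> but also by \<open>2/3 \<zeta>\<^sub>2\<close>.\<close>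


section \<open>Spectral radius and stability\<close>

text \<open>The number 2/3 is dictated by the weights in \<open>M\<close>. Let p = \<alpha>/\<mu>, b
  = ||B|| ||C||, let \<sigma> be the least singular value of Q, T = b p \<gamma>, and let U and U2
  bound the first two derivatives relative to the value matrix. The third derivative then costs 6 U2
  + 6 b U, and \<sigma> U2 contains 4 T U. The budget 4 \<open>\<zeta>\<^sub>3\<close> + 2
  \<open>\<zeta>\<^sub>4\<close> in \<open>M\<close>, times \<sigma>, has the same terms free of U
  and offers T (12 \<open>\<zeta>\<^sub>1\<close> + 8 \<open>\<zeta>\<^sub>2\<close>) for 24 T U.
  Half of this is paid by U \<le> \<open>\<zeta>\<^sub>1\<close>; the other half needs 12 U \<le> 8
  \<open>\<zeta>\<^sub>2\<close>. Of the two factors \<alpha> in \<open>M\<close>, one bounds the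
  pairing of the value matrix with the second moment, the other sits in p, which bounds the value
  matrix itself. Dividing by \<sigma> returns from |x|^2 to the stage cost, and sqrt(md) counts the
  columns of the Hessian. The spectral radius does not speak of trajectories directly. Polynomials
  annihilating a single vector bridge the gap in place of a Jordan form: their roots are peeled off
  one at a time.\<close>

definition schur_stable :: "real^'n^'n \<Rightarrow> bool" where
  "schur_stable A \<longleftrightarrow> (\<forall>x. (\<lambda>t. ((*v) A ^^ t) x) \<longlonglongrightarrow> 0)"

lemma norm_scalar_mult_complex: "norm (c *s (x :: complex^'n)) = cmod c * norm x"
  by (simp add: norm_vec_def vector_scalar_mult_def norm_mult L2_set_right_distrib)

text \<open>Summing the recursion over t < N bounds the partial sum S by |v 0| + |l| S + W, with W
  the total of the norms of \<open>w\<close>; as |l| < 1, S can be absorbed on the left.\<close>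

lemma summable_affine_recursion:
  fixes v w :: "nat \<Rightarrow> complex^'n"
  assumes rec: "\<And>t. v (Suc t) = l *s v t + w t" and l: "cmod l < 1"
    and w: "summable (\<lambda>t. norm (w t))"
  shows "summable (\<lambda>t. norm (v t))"
proof -
  define W where "W = (\<Sum>t. norm (w t))"
  have step: "norm (v (Suc t)) \<le> cmod l * norm (v t) + norm (w t)" for t
    unfolding rec by (metis norm_scalar_mult_complex norm_triangle_ineq)
  have "(\<Sum>t<N. norm (v t)) \<le> (norm (v 0) + W) / (1 - cmod l)" for N
  proof -
    have "(\<Sum>t<N. norm (v t)) \<le> (\<Sum>t<Suc N. norm (v t))"
      by simp
    also have "\<dots> = norm (v 0) + (\<Sum>t<N. norm (v (Suc t)))"
      by (rule sum.lessThan_Suc_shift)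
    also have "\<dots> \<le> norm (v 0) + (\<Sum>t<N. cmod l * norm (v t) + norm (w t))"
      by (intro add_left_mono sum_mono step)
    also have "\<dots> = norm (v 0) + cmod l * (\<Sum>t<N. norm (v t)) + (\<Sum>t<N. norm (w t))"
      by (simp add: sum.distrib sum_distrib_left)
    also have "(\<Sum>t<N. norm (w t)) \<le> W"
      unfolding W_def by (intro sum_le_suminf w) auto
    finally have "(1 - cmod l) * (\<Sum>t<N. norm (v t)) \<le> norm (v 0) + W"
      by (simp add: algebra_simps)
    with l show ?thesis
      by (simp add: pos_le_divide_eq mult.commute)
  qed
  then show ?thesis
    by (intro bounded_imp_summable[where B = "(norm (v 0) + W) / (1 - cmod l)"])
       (auto simp: lessThan_Suc_atMost[symmetric] simp del: sum.lessThan_Suc)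
qed

text \<open>This is p(T) v, by Horner's scheme on the vector; matrix powers are avoided because the
  power operation on matrices is componentwise.\<close>

definition poly_act :: "complex^'n^'n \<Rightarrow> complex poly \<Rightarrow> complex^'n \<Rightarrow> complex^'n" where
  "poly_act T p = fold_coeffs (\<lambda>a f v. a *s v + f (T *v v)) p (\<lambda>_. 0)"

lemma poly_act_0 [simp]: "poly_act T 0 v = 0"
  by (simp add: poly_act_def)

lemma poly_act_pCons [simp]: "poly_act T (pCons a p) v = a *s v + poly_act T p (T *v v)"
  by (cases "a = 0 \<and> p = 0") (auto simp: poly_act_def)

lemma poly_act_add: "poly_act T (p + q) v = poly_act T p v + poly_act T q v"
  by (induction p q arbitrary: v rule: poly_induct2)
     (simp_all add: vector_sadd_rdistrib)

lemma poly_act_smult: "poly_act T (smult c p) v = c *s poly_act T p v"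
  by (induction p arbitrary: v) (simp_all add: vector_add_ldistrib vector_smult_assoc)

lemma poly_act_diff_right: "poly_act T p (v - w) = poly_act T p v - poly_act T p w"
  by (induction p arbitrary: v w)
     (simp_all add: vector_ssub_ldistrib matrix_vector_mult_diff_distrib algebra_simps)

lemma poly_act_add_right: "poly_act T p (v + w) = poly_act T p v + poly_act T p w"
  by (induction p arbitrary: v w)
     (simp_all add: vector_add_ldistrib matrix_vector_right_distrib algebra_simps)

lemma poly_act_right_0 [simp]: "poly_act T p 0 = 0"
  by (induction p) simp_all

lemma poly_act_sum_right: "poly_act T p (\<Sum>i\<in>I. f i) = (\<Sum>i\<in>I. poly_act T p (f i))"
  by (induction I rule: infinite_finite_induct) (simp_all add: poly_act_add_right)

lemma poly_act_scalar_right: "poly_act T p (c *s v) = c *s poly_act T p v"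
  by (induction p arbitrary: v)
     (simp_all add: vector_add_ldistrib vector_smult_assoc vector_scalar_commute algebra_simps)

lemma poly_act_apply: "poly_act T p (T *v v) = T *v poly_act T p v"
  by (induction p arbitrary: v)
     (simp_all add: matrix_vector_right_distrib vector_scalar_commute)

lemma poly_act_monom: "poly_act T (monom c i) v = c *s (((*v) T ^^ i) v)"
  by (induction i arbitrary: v) (simp_all add: monom_0 monom_Suc funpow_swap1)

lemma poly_act_sum: "poly_act T (\<Sum>i\<in>I. f i) v = (\<Sum>i\<in>I. poly_act T (f i) v)"
  by (induction I rule: infinite_finite_induct) (simp_all add: poly_act_add)

lemma poly_act_linear_factor:
  "poly_act T ([:- l, 1:] * p) v = poly_act T p (T *v v - l *s v)"
proof -
  have "[:- l, 1:] * p = pCons 0 p + smult (- l) p" by simp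
  then show ?thesis
    by (simp only: poly_act_add poly_act_smult poly_act_diff_right poly_act_scalar_right
        poly_act_pCons) (simp add: vector_smult_lneg)
qed

text \<open>One more iterate of \<open>v\<close> than the real dimension of the space must satisfy a
  linear relation, whose coefficients (here even real) are those of the polynomial.\<close>

lemma exists_annihilating_poly:
  fixes T :: "complex^'n^'n"
  shows "\<exists>p. p \<noteq> 0 \<and> poly_act T p v = 0"
proof -
  define f where "f i = ((*v) T ^^ i) v" for i
  define N where "N = DIM(complex^'n)"
  show ?thesis
  \<comment> \<open>\<open>dependent\<close> speaks of sets and is blind to repetitions, so two
    equal iterates are treated apart, by a difference of monomials.\<close>
  proof (cases "inj_on f {..N}")
    case False
    then obtain i j where ij: "i \<noteq> j" "f i = f j" by (auto simp: inj_on_def)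
    define p :: "complex poly" where "p = monom 1 i + monom (-1) j"
    have "coeff p i = 1" using ij by (simp add: p_def)
    then have "p \<noteq> 0" by auto
    moreover have "poly_act T p v = 0"
      using ij by (simp add: p_def poly_act_add poly_act_monom f_def vector_smult_lneg)
    ultimately show ?thesis by blast
  next
    case True
    have "card (f ` {..N}) > DIM(complex^'n)"
      unfolding N_def[symmetric] card_image[OF True] by simp
    then have "dependent (f ` {..N})"
      by (intro dependent_biggerset) auto
    then obtain u y where u: "y \<in> f ` {..N}" "u y \<noteq> 0" "(\<Sum>x\<in>f ` {..N}. u x *\<^sub>R x) = 0"
      by (subst (asm) dependent_finite) auto
    then obtain k where k: "k \<le> N" "u (f k) \<noteq> 0" by auto
    define p :: "complex poly" where "p = (\<Sum>i\<le>N. monom (of_real (u (f i))) i)"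
    have "coeff p k = of_real (u (f k))"
      using k by (simp add: p_def coeff_sum)
    then have "p \<noteq> 0" using k by auto
    moreover have "poly_act T p v = (\<Sum>i\<le>N. u (f i) *\<^sub>R f i)"
      unfolding p_def poly_act_sum poly_act_monom f_def[symmetric]
      by (intro sum.cong refl) (simp add: vec_eq_iff complex_eq_iff)
    then have "poly_act T p v = 0"
      using u(3) unfolding sum.reindex[OF True] o_def by (rule trans)
    ultimately show ?thesis by blast
  qed
qed

text \<open>A root inside the unit disc leads to a contracting recursion; a root outside is not an
  eigenvalue, so its factor can be cancelled.\<close>

lemma summable_powers_if_annihilated:
  fixes T :: "complex^'n^'n"
  assumes eig: "\<And>l x. x \<noteq> 0 \<Longrightarrow> T *v x = l *s x \<Longrightarrow> cmod l < 1"
  shows "p \<noteq> 0 \<Longrightarrow> poly_act T p v = 0 \<Longrightarrow> summable (\<lambda>t. norm (((*v) T ^^ t) v))"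
proof (induction "degree p" arbitrary: p v)
  case 0
  then obtain a where "p = [:a:]" "a \<noteq> 0"
    by (metis degree_eq_zeroE pCons_eq_0_iff)
  then have "v = 0" using 0 by (simp)
  have "((*v) T ^^ t) v = 0" for t
    by (induction t) (simp_all add: \<open>v = 0\<close>)
  then show ?case by simp
next
  case (Suc n)
  then have "\<not> constant (poly p)" by (simp add: constant_degree)
  then obtain l where "poly p l = 0"
    using fundamental_theorem_of_algebra by blast
  then obtain q where pq: "p = [:- l, 1:] * q"
    by (auto simp: poly_eq_0_iff_dvd)
  have q: "q \<noteq> 0" using Suc.prems pq by auto
  then have deg: "n = degree q"
    using Suc.hyps(2) degree_mult_eq[of "[:- l, 1:]" q] pq by simp
  show ?case
  proof (cases "cmod l < 1")
    case True
    \<comment> \<open>\<open>w\<close> is the orbit of (T - l) v, which the quotient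
      \<open>q\<close> annihilates; the induction hypothesis makes it summable.\<close>
    define w where "w t = ((*v) T ^^ t) (T *v v - l *s v)" for t
    have w: "summable (\<lambda>t. norm (w t))"
      unfolding w_def using Suc.hyps(1)[OF deg q] Suc.prems(2) pq
      by (simp only: poly_act_linear_factor)
    have rec: "((*v) T ^^ Suc t) v = l *s ((*v) T ^^ t) v + w t" for t
      unfolding w_def
      by (induction t)
         (simp_all add: matrix_vector_mult_diff_distrib matrix_vector_right_distrib
           vector_scalar_commute algebra_simps)
    show ?thesis
      by (rule summable_affine_recursion[where v = "\<lambda>t. ((*v) T ^^ t) v", OF rec True w])
  next
    case False
    have "T *v poly_act T q v = l *s poly_act T q v"
      using Suc.prems(2)
      by (simp add: pq poly_act_linear_factor poly_act_diff_right poly_act_scalar_right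
          poly_act_apply del: mult_pCons_left)
    with eig False have "poly_act T q v = 0" by blast
    then show ?thesis using Suc.hyps(1)[OF deg q] by blast
  qed
qed

lemma poly_act_mult: "poly_act T (p * q) v = poly_act T q (poly_act T p v)"
  by (induction p arbitrary: v)
     (simp_all add: poly_act_add poly_act_smult poly_act_add_right poly_act_scalar_right)

lemma poly_act_eigenvector:
  assumes "T *v x = l *s x"
  shows "poly_act T p x = poly p l *s x"
  by (induction p)
     (simp_all add: assms poly_act_scalar_right vector_smult_assoc vector_sadd_rdistrib)

text \<open>The maximum in \<open>spec_rad\<close> needs a finite set. The product of annihilating
  polynomials of the basis vectors annihilates every vector, so each eigenvalue is one of its
  roots.\<close>

lemma finite_eigenvalues:
  fixes T :: "complex^'n^'n"
  shows "finite {l. \<exists>x. x \<noteq> 0 \<and> T *v x = l *s x}"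
proof -
  have "\<forall>i. \<exists>p. p \<noteq> 0 \<and> poly_act T p (axis i 1) = 0"
    using exists_annihilating_poly by blast
  then obtain p where p: "\<And>i. p i \<noteq> 0 \<and> poly_act T (p i) (axis i 1) = 0"
    by metis
  define q where "q = (\<Prod>i\<in>UNIV. p i)"
  have "q \<noteq> 0" using p by (simp add: q_def)
  have "poly_act T q (axis i 1) = 0" for i
  proof -
    have "q = p i * (\<Prod>j\<in>UNIV - {i}. p j)"
      unfolding q_def by (rule prod.remove) auto
    then show ?thesis using p poly_act_right_0 by (simp add: poly_act_mult)
  qed
  then have "poly_act T q x = 0" for x
    using poly_act_sum_right[of T q "\<lambda>i. x $ i *s axis i 1" UNIV] poly_act_scalar_right[of T q]
    by (simp add: basis_expansion)
  then have "{l. \<exists>x. x \<noteq> 0 \<and> T *v x = l *s x} \<subseteq> {l. poly q l = 0}"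
    using poly_act_eigenvector[of T _ _ q] by fastforce
  then show ?thesis
    using poly_roots_finite[OF \<open>q \<noteq> 0\<close>] finite_subset by blast
qed

text \<open>All later arguments use the spectral radius through this lemma. The real orbit is
  embedded isometrically into the complex space, where its norms are summable and hence tend to
  0.\<close>

lemma schur_stable_if_spec_rad_less_1:
  assumes "spec_rad A < 1"
  shows "schur_stable A"
proof -
  define T :: "complex^'a^'a" where "T = (\<chi> i j. complex_of_real (A $ i $ j))"
  define c :: "real^'a \<Rightarrow> complex^'a" where "c x = (\<chi> i. complex_of_real (x $ i))" for x
  have eig: "cmod l < 1" if "x \<noteq> 0" "T *v x = l *s x" for l x
  proof -
    have "l \<in> complex_eigenvalues A"
      using that unfolding complex_eigenvalues_def T_def by blast
    then have "cmod l \<le> spec_rad A"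
      unfolding spec_rad_def by (intro Max_ge) (simp_all add: complex_eigenvalues_def finite_eigenvalues)
    with assms show ?thesis by simp
  qed
  have c: "T *v c x = c (A *v x)" for x
    by (simp add: c_def T_def vec_eq_iff matrix_vector_mult_def)
  have pow: "((*v) T ^^ t) (c x) = c (((*v) A ^^ t) x)" for t x
    by (induction t) (simp_all add: c)
  have norm: "norm (c x) = norm x" for x
    by (simp add: norm_vec_def c_def)
  have "(\<lambda>t. ((*v) A ^^ t) x) \<longlonglongrightarrow> 0" for x
  proof -
    obtain p where p: "p \<noteq> 0" "poly_act T p (c x) = 0"
      using exists_annihilating_poly by blast
    have "summable (\<lambda>t. norm (((*v) T ^^ t) (c x)))"
      by (rule summable_powers_if_annihilated[OF eig p])
    then have "(\<lambda>t. norm (((*v) A ^^ t) x)) \<longlonglongrightarrow> 0"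
      by (intro summable_LIMSEQ_zero) (simp add: pow norm)
    then show ?thesis by (rule tendsto_norm_zero_cancel)
  qed
  then show ?thesis by (simp add: schur_stable_def)
qed


section \<open>The Stein equation\<close>

lemma bounded_bilinear_matrix_mult:
  "bounded_bilinear ((**) :: real^'n^'m \<Rightarrow> real^'k^'n \<Rightarrow> real^'k^'m)"
proof -
  have "bilinear ((**) :: real^'n^'m \<Rightarrow> real^'k^'n \<Rightarrow> real^'k^'m)"
    unfolding bilinear_def
    by (auto intro!: linearI
        simp: matrix_matrix_mult_def vec_eq_iff sum.distrib algebra_simps sum_distrib_left)
  then show ?thesis
    by (simp add: bilinear_conv_bounded_bilinear)
qed

interpretation matrix_mult:
  bounded_bilinear "(**) :: real^'n^'m \<Rightarrow> real^'k^'n \<Rightarrow> real^'k^'m"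
  by (rule bounded_bilinear_matrix_mult)

lemma bounded_linear_transpose: "bounded_linear (transpose :: real^'n^'m \<Rightarrow> real^'m^'n)"
proof -
  have "linear (transpose :: real^'n^'m \<Rightarrow> real^'m^'n)"
    by (auto intro!: linearI simp: transpose_def vec_eq_iff)
  then show ?thesis
    by (simp add: linear_conv_bounded_linear)
qed

lemmas transpose_tendsto = bounded_linear.tendsto[OF bounded_linear_transpose]
lemmas transpose_add = linear_add[OF bounded_linear.linear[OF bounded_linear_transpose]]
lemmas transpose_diff = linear_diff[OF bounded_linear.linear[OF bounded_linear_transpose]]

lemma norm_transpose: "norm (transpose (X :: real^'n^'m)) = norm X"
  unfolding frobenius_norm_eq_norm[symmetric] frobenius_norm_def
  by (subst sum.swap) (simp add: transpose_def)

lemma norm_matrix_vector_le: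
  fixes X :: "real^'n^'m"
  shows "norm (X *v v) \<le> norm X * norm v"
proof -
  have "norm (X *v v) \<le> L2_set (\<lambda>i. norm (X $ i) * norm v) UNIV"
    unfolding norm_vec_def[of "X *v v"]
    by (intro L2_set_mono) (simp_all add: matrix_vector_mul_component Cauchy_Schwarz_ineq2)
  also have "\<dots> = norm X * norm v"
    by (simp add: norm_vec_def[of X] L2_set_left_distrib)
  finally show ?thesis .
qed

lemma norm_matrix_mult_le:
  fixes X :: "real^'n^'m" and Y :: "real^'k^'n"
  shows "norm (X ** Y) \<le> norm X * norm Y"
proof -
  have row: "(X ** Y) $ i = transpose Y *v (X $ i)" for i
    by (simp add: vec_eq_iff matrix_matrix_mult_def matrix_vector_mult_def transpose_def mult.commute
        del: transpose_matrix_vector)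
  have "norm (X ** Y) \<le> L2_set (\<lambda>i. norm (X $ i) * norm Y) UNIV"
    unfolding norm_vec_def[of "X ** Y"]
    by (intro L2_set_mono)
       (simp_all add: row del: transpose_matrix_vector,
        metis norm_matrix_vector_le norm_transpose mult.commute)
  also have "\<dots> = norm X * norm Y"
    by (simp add: norm_vec_def[of X] L2_set_left_distrib)
  finally show ?thesis .
qed

lemma inner_transpose_matrix: "x \<bullet> (transpose A *v y) = (A *v x) \<bullet> (y :: real^'n)"
  by (metis dot_lmul_matrix vector_transpose_matrix)

lemma abs_form_le_norm: "\<bar>x \<bullet> (X *v y)\<bar> \<le> norm X * norm x * norm (y :: real^'n)"
proof -
  have "\<bar>x \<bullet> (X *v y)\<bar> \<le> norm x * (norm X * norm y)"
    by (meson Cauchy_Schwarz_ineq2 mult_left_mono norm_ge_zero norm_matrix_vector_le order_trans)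
  then show ?thesis by (simp add: mult_ac)
qed

lemma matrix_eqI_forms:
  fixes X Y :: "real^'n^'m"
  assumes "\<And>x y. x \<bullet> (X *v y) = x \<bullet> (Y *v y)"
  shows "X = Y"
proof -
  have "X *v y = Y *v y" for y
    using assms vector_eq_ldot[of "X *v y" "Y *v y"] by blast
  then show ?thesis by (simp add: matrix_eq)
qed

section \<open>The Stein operator, its inverse and Lyapunov certificates\<close>

definition stein :: "real^'n^'n \<Rightarrow> real^'n^'n \<Rightarrow> real^'n^'n" where
  "stein A X = X - transpose A ** X ** A"

text \<open>The choice inverse is a true inverse at stable \<open>A\<close>, where
  \<open>stein A\<close> is injective and hence, in finite dimension, surjective. The usual series
  for the solution reappears in \<open>lyap_sums\<close>, tested on vectors, so no series of
  matrices has to be summed.\<close>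

definition lyap :: "real^'n^'n \<Rightarrow> real^'n^'n \<Rightarrow> real^'n^'n" where
  "lyap A = inv (stein A)"

lemma linear_stein: "linear (stein A)"
  by (rule linearI)
     (simp_all add: stein_def matrix_mult.add_left matrix_mult.add_right matrix_mult.scaleR_left
       matrix_mult.scaleR_right scaleR_diff_right)

lemma transpose_stein: "transpose (stein A X) = stein A (transpose X)"
  by (simp add: stein_def transpose_diff matrix_transpose_mul matrix_mul_assoc)

lemma stein_form:
  "x \<bullet> (stein A X *v y) = x \<bullet> (X *v y) - (A *v x) \<bullet> (X *v (A *v y))"
  by (simp add: stein_def matrix_vector_mult_diff_rdistrib inner_diff_right inner_transpose_matrix
      matrix_vector_mul_assoc[symmetric] del: transpose_matrix_vector)

text \<open>By \<open>stein_form\<close> each summand is a difference of the form of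
  \<open>X\<close> at consecutive states, so the sum telescopes.\<close>

lemma stein_iterate:
  "(\<Sum>t<N. ((*v) A ^^ t) x \<bullet> (stein A X *v ((*v) A ^^ t) y)) =
    x \<bullet> (X *v y) - ((*v) A ^^ N) x \<bullet> (X *v ((*v) A ^^ N) y)"
  by (induction N) (simp_all add: stein_form)

lemma stein_sums:
  assumes "schur_stable A"
  shows "(\<lambda>t. ((*v) A ^^ t) x \<bullet> (stein A X *v ((*v) A ^^ t) y)) sums (x \<bullet> (X *v y))"
proof -
  have "(\<lambda>N. ((*v) A ^^ N) z) \<longlonglongrightarrow> 0" for z
    using assms by (simp add: schur_stable_def)
  then have "(\<lambda>N. ((*v) A ^^ N) x \<bullet> (X *v ((*v) A ^^ N) y)) \<longlonglongrightarrow> 0 \<bullet> (X *v 0)"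
    by (intro tendsto_intros bounded_linear.tendsto[OF matrix_vector_mul_bounded_linear])
  then have "(\<lambda>N. x \<bullet> (X *v y) - ((*v) A ^^ N) x \<bullet> (X *v ((*v) A ^^ N) y)) \<longlonglongrightarrow> x \<bullet> (X *v y) - 0"
    by (intro tendsto_intros) simp
  then show ?thesis
    unfolding sums_def stein_iterate by simp
qed

lemma inj_stein:
  assumes "schur_stable A"
  shows "inj (stein A)"
proof -
  have "X = 0" if "stein A X = 0" for X
  proof (rule matrix_eqI_forms)
    fix x y
    have "(\<lambda>t. 0) sums (x \<bullet> (X *v y))"
      using stein_sums[OF assms, of x X y] that by simp
    from sums_unique2[OF this sums_zero] show "x \<bullet> (X *v y) = x \<bullet> (0 *v y)"
      by simp
  qed
  then show ?thesis
    by (simp add: linear_injective_0[OF linear_stein])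
qed

lemma stein_lyap: "schur_stable A \<Longrightarrow> stein A (lyap A F) = F"
  unfolding lyap_def
  by (rule surj_f_inv_f) (rule linear_inj_imp_surj[OF linear_stein inj_stein])

lemma lyap_stein: "schur_stable A \<Longrightarrow> lyap A (stein A X) = X"
  unfolding lyap_def by (rule inv_f_f[OF inj_stein])

lemma lyap_eqI: "schur_stable A \<Longrightarrow> stein A X = F \<Longrightarrow> lyap A F = X"
  using lyap_stein by blast

lemma linear_lyap: "schur_stable A \<Longrightarrow> linear (lyap A)"
  by (rule linearI)
     (simp_all add: lyap_eqI linear_add[OF linear_stein] linear_scale[OF linear_stein] stein_lyap)

lemma bounded_linear_lyap: "schur_stable A \<Longrightarrow> bounded_linear (lyap A)"
  by (simp add: linear_lyap linear_conv_bounded_linear[symmetric])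

lemma transpose_lyap: "schur_stable A \<Longrightarrow> transpose (lyap A F) = lyap A (transpose F)"
  by (rule lyap_eqI[symmetric]) (simp_all add: transpose_stein[symmetric] stein_lyap)

lemma lyap_sums:
  "schur_stable A \<Longrightarrow>
    (\<lambda>t. ((*v) A ^^ t) x \<bullet> (F *v ((*v) A ^^ t) y)) sums (x \<bullet> (lyap A F *v y))"
  using stein_sums[of A x "lyap A F" y] by (simp add: stein_lyap)

lemma lyap_nonneg:
  assumes "schur_stable A" and "\<And>x. 0 \<le> x \<bullet> (F *v x)"
  shows "0 \<le> x \<bullet> (lyap A F *v x)"
  by (rule sums_le[OF _ sums_zero lyap_sums[OF assms(1)]]) (rule assms(2))

text \<open>Both solutions are series along the same trajectory, so they are compared term by term
  and \<open>u\<close> survives without a loss depending on \<open>A\<close>.\<close>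

lemma lyap_dominated:
  assumes A: "schur_stable A" and dom: "\<And>x. \<bar>x \<bullet> (F *v x)\<bar> \<le> u * (x \<bullet> (S *v x))"
  shows "\<bar>x \<bullet> (lyap A F *v x)\<bar> \<le> u * (x \<bullet> (lyap A S *v x))"
proof (rule abs_leI)
  note F = lyap_sums[OF A, of x F x] and S = sums_mult[OF lyap_sums[OF A, of x S x], of u]
  show "x \<bullet> (lyap A F *v x) \<le> u * (x \<bullet> (lyap A S *v x))"
    using dom by (intro sums_le[OF _ F S]) (simp add: abs_le_iff)
  show "- (x \<bullet> (lyap A F *v x)) \<le> u * (x \<bullet> (lyap A S *v x))"
    using dom by (intro sums_le[OF _ sums_minus[OF F] S]) (simp add: abs_le_iff)
qed

text \<open>Summed along a trajectory, the decrease is paid out of the initial value of the form of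
  \<open>P\<close>; the squared norms are therefore summable.\<close>

lemma schur_stable_if_lyapunov:
  assumes nonneg: "\<And>x. 0 \<le> x \<bullet> (P *v x)"
    and decrease: "\<And>x. c * (norm x)\<^sup>2 \<le> x \<bullet> (stein A P *v x)" and c: "c > 0"
  shows "schur_stable A"
  unfolding schur_stable_def
proof
  fix x
  define v where "v t = ((*v) A ^^ t) x" for t
  have "(\<Sum>t<N. (norm (v t))\<^sup>2) \<le> (x \<bullet> (P *v x)) / c" for N
  proof -
    have "c * (\<Sum>t<N. (norm (v t))\<^sup>2) \<le> (\<Sum>t<N. v t \<bullet> (stein A P *v v t))"
      unfolding sum_distrib_left by (intro sum_mono decrease)
    also have "\<dots> \<le> x \<bullet> (P *v x)"
      using nonneg by (simp add: v_def stein_iterate)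
    finally show ?thesis using c by (simp add: pos_le_divide_eq mult.commute)
  qed
  then have "summable (\<lambda>t. (norm (v t))\<^sup>2)"
    by (intro bounded_imp_summable[where B = "(x \<bullet> (P *v x)) / c"])
       (auto simp: lessThan_Suc_atMost[symmetric] simp del: sum.lessThan_Suc)
  then have "(\<lambda>t. (norm (v t))\<^sup>2) \<longlonglongrightarrow> 0"
    by (rule summable_LIMSEQ_zero)
  then have "(\<lambda>t. sqrt ((norm (v t))\<^sup>2)) \<longlonglongrightarrow> 0"
    using tendsto_real_sqrt by fastforce
  then show "(\<lambda>t. ((*v) A ^^ t) x) \<longlonglongrightarrow> 0"
    by (simp add: v_def tendsto_norm_zero_iff)
qed

text \<open>The solution \<open>P\<close> for the identity matrix certifies the stability of
  \<open>A\<close>. As \<open>stein M P\<close> depends continuously on \<open>M\<close>, it stays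
  within 1/2 of the identity near \<open>A\<close> and keeps half of the decrease, so the same
  \<open>P\<close> certifies \<open>M\<close>.\<close>

lemma open_schur_stable: "open {A :: real^'n^'n. schur_stable A}"
proof (subst open_subopen, intro ballI)
  fix A :: "real^'n^'n"
  assume "A \<in> {A. schur_stable A}"
  then have A: "schur_stable A" by simp
  define P where "P = lyap A (mat 1)"
  have P: "0 \<le> x \<bullet> (P *v x)" for x
    unfolding P_def by (rule lyap_nonneg[OF A]) simp
  have "((\<lambda>M. stein M P) \<longlongrightarrow> stein A P) (nhds A)"
    unfolding stein_def
    by (intro tendsto_intros matrix_mult.tendsto transpose_tendsto filterlim_ident)
  then have "\<forall>\<^sub>F M in nhds A. dist (stein M P) (stein A P) < 1 / 2"
    by (rule tendstoD) simp
  then have "\<forall>\<^sub>F M in nhds A. schur_stable M"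
  proof (rule eventually_mono)
    fix M
    assume M: "dist (stein M P) (stein A P) < 1 / 2"
    show "schur_stable M"
    proof (rule schur_stable_if_lyapunov[OF P])
      fix x
      have "\<bar>x \<bullet> ((stein M P - stein A P) *v x)\<bar> \<le> norm (stein M P - stein A P) * norm x * norm x"
        by (rule abs_form_le_norm)
      also have "\<dots> \<le> 1 / 2 * norm x * norm x"
        using M by (intro mult_right_mono) (simp_all add: dist_norm)
      finally have "\<bar>x \<bullet> (stein M P *v x) - x \<bullet> x\<bar> \<le> 1 / 2 * (norm x)\<^sup>2"
        by (simp add: P_def stein_lyap[OF A] matrix_vector_mult_diff_rdistrib inner_diff_right
            power2_eq_square)
      then show "1 / 2 * (norm x)\<^sup>2 \<le> x \<bullet> (stein M P *v x)"
        unfolding dot_square_norm by linarith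
    qed simp
  qed
  then obtain U where "open U" "A \<in> U" "\<forall>M\<in>U. schur_stable M"
    unfolding eventually_nhds by blast
  then show "\<exists>U. open U \<and> A \<in> U \<and> U \<subseteq> {A. schur_stable A}"
    by blast
qed

section \<open>Differentiating the solution of the Stein equation\<close>

lemma has_derivative_matrix_mult [derivative_intros]:
  fixes X :: "'a::real_normed_vector \<Rightarrow> real^'n^'m" and Y :: "'a \<Rightarrow> real^'k^'n"
  assumes "(X has_derivative dX) (at k within S)" "(Y has_derivative dY) (at k within S)"
  shows "((\<lambda>y. X y ** Y y) has_derivative (\<lambda>h. X k ** dY h + dX h ** Y k)) (at k within S)"
  by (rule matrix_mult.FDERIV[OF assms])

lemmas has_derivative_transpose [derivative_intros] =
  bounded_linear.has_derivative[OF bounded_linear_transpose]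

text \<open>The increment \<open>D\<close> of the solution satisfies \<open>stein (Ac k) D = G + o(D)\<close>, where \<open>G\<close> is the
  residual of the old solution in the new equation.\<close>

lemma has_derivative_lyap:
  fixes Ac F :: "'a::real_normed_vector \<Rightarrow> real^'n^'n"
  assumes stable: "schur_stable (Ac k)"
    and dA: "(Ac has_derivative dA) (at k)" and dF: "(F has_derivative dF) (at k)"
  defines "X \<equiv> lyap (Ac k) (F k)"
  shows "((\<lambda>y. lyap (Ac y) (F y)) has_derivative
    (\<lambda>h. lyap (Ac k) (dF h + transpose (dA h) ** X ** Ac k + transpose (Ac k) ** X ** dA h))) (at k)"
proof -
  define D where "D y = lyap (Ac y) (F y) - X" for y
  define G where "G y = F y - stein (Ac y) X" for y
  define dG where
    "dG h = dF h + transpose (dA h) ** X ** Ac k + transpose (Ac k) ** X ** dA h" for h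
  \<comment> \<open>The increment is measured with the operator frozen at \<open>k\<close>;
    \<open>r\<close> is the price of freezing it and turns out to be of higher order.\<close>
  define r where "r y = stein (Ac k) (D y) - stein (Ac y) (D y)" for y
  define e where "e y = norm (Ac y - Ac k) * (norm (Ac y) + norm (Ac k))" for y
  note blin = bounded_linear_lyap[OF stable]
  have GX: "(G has_derivative dG) (at k)"
    unfolding G_def stein_def
    by (rule has_derivative_eq_rhs, (rule derivative_intros dA dF)+)
       (simp add: dG_def fun_eq_iff matrix_mult.add_left matrix_mul_assoc)
  have [simp]: "G k = 0" "D k = 0"
    by (simp_all add: G_def D_def X_def stein_lyap[OF stable])
  have contA: "(Ac \<longlongrightarrow> Ac k) (at k)"
    using has_derivative_continuous[OF dA] by (simp add: continuous_at)
  have ev_stable: "\<forall>\<^sub>F y in at k. schur_stable (Ac y)"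
    using topological_tendstoD[OF contA open_schur_stable] stable by simp
  have e0: "(e \<longlongrightarrow> 0) (at k)"
  proof -
    have "(e \<longlongrightarrow> norm (Ac k - Ac k) * (norm (Ac k) + norm (Ac k))) (at k)"
      unfolding e_def by (intro tendsto_intros contA)
    then show ?thesis by simp
  qed
  have r_le: "norm (r y) \<le> e y * norm (D y)" for y
  proof -
    have "r y = transpose (Ac y - Ac k) ** D y ** Ac y + transpose (Ac k) ** D y ** (Ac y - Ac k)"
      by (simp add: r_def stein_def transpose_diff matrix_mult.diff_left matrix_mult.diff_right)
    also have "norm \<dots> \<le> norm (transpose (Ac y - Ac k)) * norm (D y) * norm (Ac y)
        + norm (transpose (Ac k)) * norm (D y) * norm (Ac y - Ac k)"
      by (intro norm_triangle_le add_mono order_trans[OF norm_matrix_mult_le] mult_right_mono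
          norm_matrix_mult_le norm_ge_zero)
    finally show ?thesis by (simp add: norm_transpose e_def algebra_simps)
  qed
  have D_eq: "\<forall>\<^sub>F y in at k. D y = lyap (Ac k) (G y) + lyap (Ac k) (r y)"
    using ev_stable
  proof eventually_elim
    case (elim y)
    have "stein (Ac k) (D y) = G y + r y"
      by (simp add: r_def G_def D_def linear_diff[OF linear_stein] stein_lyap[OF elim])
    then have "D y = lyap (Ac k) (G y + r y)"
      using lyap_stein[OF stable] by metis
    then show ?case by (simp add: linear_add[OF linear_lyap[OF stable]])
  qed
  obtain C where C: "C > 0" "\<And>V. norm (lyap (Ac k) V) \<le> norm V * C"
    using bounded_linear.pos_bounded[OF blin] by blast
  \<comment> \<open>Below this threshold the contribution of \<open>r\<close> is at most half the
    norm of \<open>D y\<close> and is absorbed, which leaves \<open>D\<close> controlled by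
    \<open>G\<close>.\<close>
  have "\<forall>\<^sub>F y in at k. e y < 1 / (2 * C)"
    using order_tendstoD(2)[OF e0] C(1) by simp
  then have D_le: "\<forall>\<^sub>F y in at k. norm (D y) \<le> 2 * C * norm (G y)"
    using D_eq
  proof eventually_elim
    case (elim y)
    have "norm (D y) \<le> norm (G y) * C + norm (r y) * C"
      unfolding elim(2) by (intro norm_triangle_le add_mono C)
    also have "norm (r y) * C \<le> (1 / (2 * C) * norm (D y)) * C"
      using C(1) elim(1) r_le[of y]
      by (intro mult_right_mono order_trans[OF r_le] norm_ge_zero) auto
    finally show ?case using C(1) by (simp add: field_simps)
  qed
  obtain B where B: "B > 0" "\<And>h. norm (dG h) \<le> norm h * B"
    using bounded_linear.pos_bounded[OF has_derivative_bounded_linear[OF GX]] by blast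
  have "((\<lambda>y. norm (G y - G k - dG (y - k)) / norm (y - k)) \<longlongrightarrow> 0) (at k)"
    using GX by (simp add: has_derivative_iff_norm)
  then have "\<forall>\<^sub>F y in at k. norm (G y - G k - dG (y - k)) / norm (y - k) < 1"
    by (rule order_tendstoD(2)) simp
  then have G_le: "\<forall>\<^sub>F y in at k. norm (G y) \<le> (B + 1) * norm (y - k)"
    using eventually_neq_at_within[of k k UNIV]
  proof eventually_elim
    case (elim y)
    have "norm (G y - dG (y - k)) \<le> norm (y - k)"
      using elim by (simp add: divide_less_eq)
    moreover have "norm (dG (y - k)) \<le> norm (y - k) * B" by (rule B)
    moreover have "norm (G y) \<le> norm (G y - dG (y - k)) + norm (dG (y - k))"
      using norm_triangle_sub[of "G y" "dG (y - k)"] by linarith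
    ultimately show ?case by (simp add: algebra_simps)
  qed
  \<comment> \<open>Here |r| \<le> e |D| \<le> 2 C e |G|, with |G| = O(|y - k|) and e tending to 0,
    so this term is o(|y - k|).\<close>
  have "((\<lambda>y. lyap (Ac k) (r y)) has_derivative (\<lambda>h. 0)) (at k)"
    unfolding has_derivative_iff_norm
  proof (intro conjI)
    have bound: "\<forall>\<^sub>F y in at k. norm (norm (lyap (Ac k) (r y)) / norm (y - k)) \<le> e y * (2 * C * (B + 1) * C)"
      using D_le G_le
    proof eventually_elim
      case (elim y)
      have e: "0 \<le> e y" by (simp add: e_def)
      have "norm (lyap (Ac k) (r y)) \<le> norm (r y) * C"
        by (rule C)
      also have "\<dots> \<le> e y * norm (D y) * C"
        using C(1) by (intro mult_right_mono r_le) simp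
      also have "\<dots> \<le> e y * (2 * C * ((B + 1) * norm (y - k))) * C"
        using C(1) e elim
        by (intro mult_right_mono mult_left_mono) (auto intro: order_trans)
      finally show ?case
        using C(1) B(1) e by (cases "y = k") (simp_all add: divide_le_eq algebra_simps)
    qed
    have "((\<lambda>y. norm (lyap (Ac k) (r y)) / norm (y - k)) \<longlongrightarrow> 0) (at k)"
      by (rule Lim_null_comparison[OF bound tendsto_mult_left_zero[OF e0]])
    moreover have "lyap (Ac k) (r k) = 0"
      by (simp add: r_def linear_0[OF linear_lyap[OF stable]] linear_0[OF linear_stein])
    ultimately show "((\<lambda>y. norm (lyap (Ac k) (r y) - lyap (Ac k) (r k) - 0) / norm (y - k)) \<longlongrightarrow> 0) (at k)"
      by simp
  qed simp
  then have "((\<lambda>y. X + (lyap (Ac k) (G y) + lyap (Ac k) (r y))) has_derivative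
      (\<lambda>h. 0 + (lyap (Ac k) (dG h) + 0))) (at k)"
    by (intro has_derivative_add has_derivative_const bounded_linear.has_derivative[OF blin] GX)
  then have "((\<lambda>y. X + (lyap (Ac k) (G y) + lyap (Ac k) (r y))) has_derivative
      (\<lambda>h. lyap (Ac k) (dG h))) (at k)"
    by simp
  then have "((\<lambda>y. lyap (Ac y) (F y)) has_derivative (\<lambda>h. lyap (Ac k) (dG h))) (at k)"
  proof (rule has_derivative_transform_eventually)
    show "\<forall>\<^sub>F y in at k. X + (lyap (Ac k) (G y) + lyap (Ac k) (r y)) = lyap (Ac y) (F y)"
      using D_eq by eventually_elim (simp add: D_def algebra_simps)
    have "r k = 0"
      by (simp add: r_def)
    then show "X + (lyap (Ac k) (G k) + lyap (Ac k) (r k)) = lyap (Ac k) (F k)"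
      by (simp add: X_def linear_0[OF linear_lyap[OF stable]])
  qed simp
  then show ?thesis by (simp only: dG_def)
qed


section \<open>Quadratic forms, singular values and second moments\<close>

text \<open>For positive f and g the right-hand side is least at s = sqrt(g / f), where it equals 2
  sqrt(f g).\<close>

lemma le_sqrt_mult_if_scaled:
  fixes a f g :: real
  assumes f: "0 \<le> f" and g: "0 \<le> g" and le: "\<And>s. 0 < s \<Longrightarrow> 2 * a \<le> s * f + g / s"
  shows "a \<le> sqrt f * sqrt g"
proof (cases "a \<le> 0")
  case True
  then show ?thesis
    using f g by (meson mult_nonneg_nonneg order_trans real_sqrt_ge_zero)
next
  case a: False
  show ?thesis
  proof (cases "f = 0 \<or> g = 0")
    case True
    then show ?thesis
    proof
      \<comment> \<open>If f or g vanishes, s is chosen extreme enough to push the right-hand side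
        down to at most \<open>a\<close>, which contradicts a > 0.\<close>
      assume "f = 0"
      moreover have "g / ((g + 1) / a) \<le> a"
        using a g by (simp add: divide_le_eq)
      ultimately show ?thesis using le[of "(g + 1) / a"] a g by simp
    next
      assume "g = 0"
      moreover have "a / (f + 1) * f \<le> a"
        using a f by (simp add: divide_le_eq)
      ultimately show ?thesis using le[of "a / (f + 1)"] a f by simp
    qed
  next
    case False
    with f g have pos: "0 < sqrt f" "0 < sqrt g" by auto
    have "sqrt g / sqrt f * f = sqrt f * sqrt g"
      using pos f real_sqrt_mult_self[of f] by (simp add: divide_simps)
    moreover have "g / (sqrt g / sqrt f) = sqrt f * sqrt g"
      using pos g real_sqrt_mult_self[of g] by (simp add: divide_simps)
    ultimately show ?thesis
      using le[of "sqrt g / sqrt f"] pos by simp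
  qed
qed

lemma symmetric_form_commute:
  "transpose X = X \<Longrightarrow> x \<bullet> (X *v y) = y \<bullet> (X *v (x :: real^'n))"
  by (metis inner_commute inner_transpose_matrix)

text \<open>Polarization reduces the mixed term to the forms at x + y and x - y, and the
  parallelogram law for \<open>P\<close> returns to x and y. Rescaling x by sqrt s and y by 1 / sqrt
  s then turns the arithmetic mean into a geometric one. \<open>X\<close> may be indefinite, as the
  derivatives of the value matrix may be.\<close>

lemma dominated_form_Cauchy_Schwarz:
  fixes X P :: "real^'n^'n"
  assumes sym: "transpose X = X" and u: "0 \<le> u" and P: "\<And>x. 0 \<le> x \<bullet> (P *v x)"
    and dom: "\<And>x. \<bar>x \<bullet> (X *v x)\<bar> \<le> u * (x \<bullet> (P *v x))"
  shows "\<bar>x \<bullet> (X *v y)\<bar> \<le> u * (sqrt (x \<bullet> (P *v x)) * sqrt (y \<bullet> (P *v y)))"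
proof -
  define f where "f z = u * (z \<bullet> (P *v z))" for z
  have f: "0 \<le> f z" for z using u P by (simp add: f_def)
  have polar: "2 * \<bar>x \<bullet> (X *v y)\<bar> \<le> f x + f y" for x y
  proof -
    have "4 * (x \<bullet> (X *v y)) = (x + y) \<bullet> (X *v (x + y)) - (x - y) \<bullet> (X *v (x - y))"
      using symmetric_form_commute[OF sym, of x y]
      by (simp add: matrix_vector_right_distrib matrix_vector_mult_diff_distrib
          inner_add_left inner_add_right inner_diff_left inner_diff_right)
    moreover have "f (x + y) + f (x - y) = 2 * f x + 2 * f y"
      by (simp add: f_def matrix_vector_right_distrib matrix_vector_mult_diff_distrib
          inner_add_left inner_add_right inner_diff_left inner_diff_right algebra_simps)
    ultimately show ?thesis
      using dom[of "x + y"] dom[of "x - y"] unfolding f_def[symmetric] by linarith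
  qed
  have "\<bar>x \<bullet> (X *v y)\<bar> \<le> sqrt (f x) * sqrt (f y)"
  proof (rule le_sqrt_mult_if_scaled[OF f f])
    fix s :: real
    assume s: "0 < s"
    have "(sqrt s *\<^sub>R x) \<bullet> (X *v (inverse (sqrt s) *\<^sub>R y)) = x \<bullet> (X *v y)"
      using s by (simp add: matrix_vector_mult_scaleR)
    moreover have "f (sqrt s *\<^sub>R x) = s * f x" "f (inverse (sqrt s) *\<^sub>R y) = f y / s"
      using s by (simp_all add: f_def matrix_vector_mult_scaleR divide_simps)
    ultimately show "2 * \<bar>x \<bullet> (X *v y)\<bar> \<le> s * f x + f y / s"
      using polar[of "sqrt s *\<^sub>R x" "inverse (sqrt s) *\<^sub>R y"] by simp
  qed
  also have "\<dots> = u * (sqrt (x \<bullet> (P *v x)) * sqrt (y \<bullet> (P *v y)))"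
    using u by (simp add: f_def real_sqrt_mult)
  finally show ?thesis .
qed

lemma symmetric_form_Cauchy_Schwarz:
  fixes P :: "real^'n^'n"
  assumes "transpose P = P" and "\<And>x. 0 \<le> x \<bullet> (P *v x)"
  shows "\<bar>x \<bullet> (P *v y)\<bar> \<le> sqrt (x \<bullet> (P *v x)) * sqrt (y \<bullet> (P *v y))"
  using dominated_form_Cauchy_Schwarz[of P 1 P x y] assms by simp

section \<open>The induced norm and the least singular value\<close>

lemma norm2_nonneg: "0 \<le> norm2 X"
  unfolding norm2_def by (rule onorm_pos_le) simp

lemma norm_mult_le_norm2: "norm (X *v x) \<le> norm2 X * norm x"
  unfolding norm2_def by (rule onorm) simp

lemma abs_form_le_norm2: "\<bar>x \<bullet> (X *v y)\<bar> \<le> norm2 X * (norm x * norm y)"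
proof -
  have "\<bar>x \<bullet> (X *v y)\<bar> \<le> norm x * norm (X *v y)"
    by (rule Cauchy_Schwarz_ineq2)
  also have "\<dots> \<le> norm x * (norm2 X * norm y)"
    by (intro mult_left_mono norm_mult_le_norm2) simp
  finally show ?thesis by (simp add: mult_ac)
qed

lemma sym_pos_def_nonneg: "sym_pos_def M \<Longrightarrow> 0 \<le> x \<bullet> (M *v x)"
  by (cases "x = 0") (auto simp: sym_pos_def_def less_imp_le)

text \<open>If \<open>e\<close> minimizes the form \<open>f\<close> on the unit sphere, then
  \<open>N\<close> = M - f(e) I is positive semidefinite and its form vanishes at \<open>e\<close>.
  Cauchy-Schwarz for \<open>N\<close> forces N e = 0, so f(e) is an eigenvalue of the symmetric
  \<open>M\<close> and thus a singular value.\<close>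

lemma sym_pos_def_least_eigenvalue:
  fixes M :: "real^'n^'n"
  assumes M: "sym_pos_def M"
  obtains l where "l \<in> singular_values M" "\<And>x. l * (norm x)\<^sup>2 \<le> x \<bullet> (M *v x)"
proof -
  define f where "f x = x \<bullet> (M *v x)" for x
  have "axis undefined 1 \<in> sphere (0 :: real^'n) 1" by simp
  then have "sphere (0 :: real^'n) 1 \<noteq> {}" by blast
  moreover have "continuous_on (sphere 0 1) f"
    unfolding f_def
    by (intro continuous_intros linear_continuous_on matrix_vector_mul_bounded_linear)
  ultimately obtain e where e: "norm e = 1" "\<And>y. norm y = 1 \<Longrightarrow> f e \<le> f y"
    using continuous_attains_inf[of "sphere 0 1" f] by auto
  define N where "N = M - f e *\<^sub>R mat 1"
  have N_form: "x \<bullet> (N *v y) = x \<bullet> (M *v y) - f e * (x \<bullet> y)" for x y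
    by (simp add: N_def matrix_vector_mult_diff_rdistrib scaleR_matrix_vector_assoc[symmetric]
        inner_diff_right)
  have f_le: "f e * (norm x)\<^sup>2 \<le> x \<bullet> (M *v x)" for x
  proof (cases "x = 0")
    case False
    then have "f e \<le> f (inverse (norm x) *\<^sub>R x)"
      by (intro e(2)) simp
    also have "\<dots> = (x \<bullet> (M *v x)) / (norm x)\<^sup>2"
      by (simp add: f_def matrix_vector_mult_scaleR divide_simps power2_eq_square)
    finally show ?thesis using False by (simp add: pos_le_divide_eq)
  qed simp
  have "transpose N = N"
    using M by (simp add: N_def transpose_diff transpose_scalar sym_pos_def_def)
  moreover have "0 \<le> x \<bullet> (N *v x)" for x
    using f_le[of x] by (simp add: N_form power2_norm_eq_inner)
  ultimately have "\<bar>y \<bullet> (N *v e)\<bar> \<le> sqrt (y \<bullet> (N *v y)) * sqrt (e \<bullet> (N *v e))" for y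
    by (rule symmetric_form_Cauchy_Schwarz)
  moreover have "e \<bullet> (N *v e) = 0"
    using e(1) by (simp add: N_form f_def dot_square_norm)
  ultimately have "y \<bullet> (N *v e) = 0" for y by simp
  then have "N *v e = 0"
    by (metis inner_eq_zero_iff)
  then have eig: "M *v e = f e *\<^sub>R e"
    by (simp add: N_def matrix_vector_mult_diff_rdistrib scaleR_matrix_vector_assoc[symmetric])
  have "f e \<in> singular_values M"
    unfolding singular_values_def
  proof (intro CollectI conjI exI)
    show "e \<noteq> 0" using e(1) by auto
    show "0 \<le> f e" unfolding f_def by (rule sym_pos_def_nonneg[OF M])
    show "(transpose M ** M) *v e = (f e)\<^sup>2 *\<^sub>R e"
      using M by (simp add: sym_pos_def_def matrix_vector_mul_assoc[symmetric] eig
          matrix_vector_mult_scaleR power2_eq_square)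
  qed
  then show ?thesis using f_le that by blast
qed

lemma sigma_min_le_form:
  assumes "sym_pos_def M"
  shows "sigma_min M * (norm x)\<^sup>2 \<le> x \<bullet> (M *v x)"
proof -
  obtain l where l: "l \<in> singular_values M" "\<And>x. l * (norm x)\<^sup>2 \<le> x \<bullet> (M *v x)"
    using sym_pos_def_least_eigenvalue[OF assms] by blast
  have "sigma_min M \<le> l"
    unfolding sigma_min_def by (rule Min_le[OF finite_singular_values l(1)])
  then have "sigma_min M * (norm x)\<^sup>2 \<le> l * (norm x)\<^sup>2"
    by (rule mult_right_mono) simp
  with l(2) show ?thesis by (rule order_trans[rotated])
qed

lemma sigma_min_pos:
  assumes M: "sym_pos_def M"
  shows "0 < sigma_min M"
proof -
  \<comment> \<open>Only for a nonempty set is \<open>Min\<close> known to be one of its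
    elements.\<close>
  have "singular_values M \<noteq> {}"
    using sym_pos_def_least_eigenvalue[OF M] by blast
  then have "sigma_min M \<in> singular_values M"
    unfolding sigma_min_def by (rule Min_in[OF finite_singular_values])
  then obtain x where x: "0 \<le> sigma_min M" "x \<noteq> 0"
      "(transpose M ** M) *v x = (sigma_min M)\<^sup>2 *\<^sub>R x"
    by (auto simp: singular_values_def)
  have "sigma_min M \<noteq> 0"
  proof
    assume "sigma_min M = 0"
    then have "x \<bullet> (transpose M *v (M *v x)) = 0"
      using x(3) unfolding matrix_vector_mul_assoc by simp
    then have "M *v x = 0"
      by (simp add: inner_transpose_matrix del: transpose_matrix_vector)
    then show False
      using M x(2) by (auto simp: sym_pos_def_def dest!: spec[of _ x])
  qed
  with x(1) show ?thesis by simp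
qed

section \<open>Quadratic forms averaged over the initial state\<close>

lemma form_eq_inner: "(x :: real^'n) \<bullet> (X *v x) = X \<bullet> (\<chi> i j. x $ i * x $ j)"
  by (simp add: inner_vec_def matrix_vector_mult_def sum_distrib_left mult_ac inner_real_def)

text \<open>The integral of a non-integrable function defaults to 0, which is not positive
  definite.\<close>

lemma integrable_second_moment:
  assumes "sym_pos_def (second_moment D)"
  shows "integrable D (\<lambda>x. \<chi> i j. x $ i * x $ j)"
proof (rule ccontr)
  assume "\<not> ?thesis"
  then have "second_moment D = 0"
    by (simp add: second_moment_def not_integrable_integral_eq)
  moreover have "axis undefined 1 \<noteq> (0 :: real^'a)" by simp
  ultimately show False
    using assms unfolding sym_pos_def_def by (metis matrix_vector_mult_0 inner_zero_right less_irrefl)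
qed

lemma integrable_form:
  assumes "sym_pos_def (second_moment D)"
  shows "integrable D (\<lambda>x. x \<bullet> (X *v x))"
  unfolding form_eq_inner by (intro integrable_inner_right integrable_second_moment assms)

text \<open>The inner product of matrices is entrywise, so the expected form is a trace pairing,
  linear in \<open>X\<close>.\<close>

lemma integral_form:
  assumes "sym_pos_def (second_moment D)"
  shows "(\<integral>x. x \<bullet> (X *v x) \<partial>D) = X \<bullet> second_moment D"
  unfolding form_eq_inner second_moment_def
  by (intro integral_inner_right integrable_second_moment assms)

lemma inner_moment_mono:
  assumes "sym_pos_def (second_moment D)" and "\<And>x. x \<bullet> (W *v x) \<le> x \<bullet> (P *v x)"
  shows "W \<bullet> second_moment D \<le> P \<bullet> second_moment D"
  unfolding integral_form[OF assms(1), symmetric]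
  by (intro integral_mono integrable_form assms)

lemma uminus_matrix_vector: "(- W) *v x = - (W *v (x :: real^'n))"
  by (simp add: vec_eq_iff matrix_vector_mult_def sum_negf)

lemma inner_moment_dominated:
  assumes X0: "sym_pos_def (second_moment D)"
    and dom: "\<And>x. \<bar>x \<bullet> (W *v x)\<bar> \<le> u * (x \<bullet> (P *v x))"
  shows "\<bar>W \<bullet> second_moment D\<bar> \<le> u * (P \<bullet> second_moment D)"
proof -
  have "W \<bullet> second_moment D \<le> (u *\<^sub>R P) \<bullet> second_moment D"
    "(- W) \<bullet> second_moment D \<le> (u *\<^sub>R P) \<bullet> second_moment D"
    using dom by (intro inner_moment_mono[OF X0];
        simp add: uminus_matrix_vector scaleR_matrix_vector_assoc[symmetric] abs_le_iff)+
  then show ?thesis by simp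
qed

text \<open>Cauchy--Schwarz bounds \<open>P\<close> from below by the rank-one matrix
  \<open>(P x) (P x)\<^sup>T / (x\<^sup>T P x)\<close>, whose pairing with the second moment is explicit.\<close>

lemma form_le_inner_moment:
  assumes X0: "sym_pos_def (second_moment D)"
    and sym: "transpose P = P" and P: "\<And>x. 0 \<le> x \<bullet> (P *v x)"
  shows "sigma_min (second_moment D) * (x \<bullet> (P *v x)) \<le> (P \<bullet> second_moment D) * (norm x)\<^sup>2"
proof -
  define q where "q = x \<bullet> (P *v x)"
  define v where "v = P *v x"
  define \<mu> where "\<mu> = sigma_min (second_moment D)"
  define W where "W = (\<chi> i j. v $ i * v $ j)"
  have \<mu>: "0 < \<mu>" unfolding \<mu>_def by (rule sigma_min_pos[OF X0])
  have q: "0 \<le> q" unfolding q_def by (rule P)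
  have W_form: "y \<bullet> (W *v y) = (y \<bullet> v)\<^sup>2" for y
    by (simp add: W_def inner_vec_def matrix_vector_mult_def power2_eq_square sum_product
        sum_distrib_left mult_ac)
  have W_inner: "W \<bullet> X = v \<bullet> (X *v v)" for X
    unfolding form_eq_inner W_def by (rule inner_commute)
  have "y \<bullet> (W *v y) \<le> y \<bullet> ((q *\<^sub>R P) *v y)" for y
  proof -
    have "\<bar>y \<bullet> v\<bar> \<le> sqrt (y \<bullet> (P *v y)) * sqrt q"
      unfolding v_def q_def by (rule symmetric_form_Cauchy_Schwarz[OF sym P])
    then have "(y \<bullet> v)\<^sup>2 \<le> (sqrt (y \<bullet> (P *v y)) * sqrt q)\<^sup>2"
      by (simp add: abs_le_square_iff[symmetric])
    then show ?thesis
      using q P[of y] by (simp add: W_form power_mult_distrib scaleR_matrix_vector_assoc[symmetric] mult.commute)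
  qed
  then have "W \<bullet> second_moment D \<le> (q *\<^sub>R P) \<bullet> second_moment D"
    by (rule inner_moment_mono[OF X0])
  then have le: "\<mu> * (norm v)\<^sup>2 \<le> q * (P \<bullet> second_moment D)"
    using sigma_min_le_form[OF X0, of v] unfolding W_inner \<mu>_def by simp
  \<comment> \<open>Together with \<open>le\<close> this bounds \<mu> q^2 by |x|^2 q times the
    pairing, and one factor q cancels.\<close>
  have "q \<le> norm x * norm v"
    unfolding q_def v_def by (rule norm_cauchy_schwarz)
  then have "q\<^sup>2 \<le> (norm x)\<^sup>2 * (norm v)\<^sup>2"
    using power_mono[of q "norm x * norm v" 2] q by (simp add: power_mult_distrib)
  then have "\<mu> * q\<^sup>2 \<le> (norm x)\<^sup>2 * (\<mu> * (norm v)\<^sup>2)"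
    using \<mu> by (simp add: mult.left_commute)
  also have "\<dots> \<le> (norm x)\<^sup>2 * (q * (P \<bullet> second_moment D))"
    by (intro mult_left_mono le) simp
  finally have *: "q * (\<mu> * q) \<le> q * ((P \<bullet> second_moment D) * (norm x)\<^sup>2)"
    by (simp add: power2_eq_square mult_ac)
  have "0 \<le> P \<bullet> second_moment D"
    using inner_moment_mono[OF X0, of 0 P] P by simp
  then have "\<mu> * q \<le> (P \<bullet> second_moment D) * (norm x)\<^sup>2"
    using * q by (cases "q = 0") simp_all
  then show ?thesis by (simp add: \<mu>_def q_def)
qed

text \<open>Stability turns the sum over time into a quadratic form for each initial state; only
  then is the expectation taken.\<close>

lemma sof_cost_eq:
  assumes "sym_pos_def (second_moment D)" and "schur_stable (closed_loop A B C K)"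
  shows "sof_cost A B C Q R D K =
    lyap (closed_loop A B C K) (Q + transpose C ** transpose K ** R ** K ** C) \<bullet> second_moment D"
  unfolding sof_cost_def state_def integral_form[OF assms(1), symmetric]
  by (simp only: sums_unique[OF lyap_sums[OF assms(2)], symmetric])


section \<open>Derivatives of the value matrix\<close>

text \<open>For symmetric \<open>P\<close> this is a matrix plus its transpose, so right-hand sides
  stay symmetric, and its quadratic form is one cross term counted twice. The doubling is the source
  of the even constants in the bounds.\<close>

definition sym_sandwich :: "real^'n^'k \<Rightarrow> real^'k^'k \<Rightarrow> real^'n^'k \<Rightarrow> real^'n^'n" where
  "sym_sandwich X P Y = transpose X ** P ** Y + transpose Y ** P ** X"

lemma sym_sandwich_form:
  assumes "transpose P = P"
  shows "x \<bullet> (sym_sandwich X P Y *v x) = 2 * ((X *v x) \<bullet> (P *v (Y *v x)))"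
  using symmetric_form_commute[OF assms, of "X *v x" "Y *v x"]
  by (simp add: sym_sandwich_def matrix_vector_mult_add_rdistrib inner_add_right
      inner_transpose_matrix matrix_vector_mul_assoc[symmetric] del: transpose_matrix_vector)

lemma transpose_sym_sandwich:
  "transpose P = P \<Longrightarrow> transpose (sym_sandwich X P Y) = sym_sandwich X P Y"
  by (simp add: sym_sandwich_def transpose_add matrix_transpose_mul matrix_mul_assoc add.commute)

lemma sym_sandwich_commute: "sym_sandwich X P Y = sym_sandwich Y P X"
  by (simp add: sym_sandwich_def)

lemma has_derivative_sym_sandwich [derivative_intros]:
  fixes X Y :: "'a::real_normed_vector \<Rightarrow> real^'n^'k"
  assumes "(X has_derivative dX) (at k within T)" "(P has_derivative dP) (at k within T)"
    "(Y has_derivative dY) (at k within T)"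
  shows "((\<lambda>y. sym_sandwich (X y) (P y) (Y y)) has_derivative
    (\<lambda>h. sym_sandwich (dX h) (P k) (Y k) + sym_sandwich (X k) (dP h) (Y k)
      + sym_sandwich (X k) (P k) (dY h))) (at k within T)"
  unfolding sym_sandwich_def
  by (rule has_derivative_eq_rhs, (rule derivative_intros assms)+)
     (simp add: fun_eq_iff matrix_mult.add_left matrix_mult.add_right)

lemma sym_sandwich_zero:
  fixes X Y :: "real^'n^'k"
  shows "sym_sandwich 0 P Y = 0" "sym_sandwich X 0 Y = 0" "sym_sandwich X P 0 = 0"
proof -
  have "transpose (0 :: real^'n^'k) = 0"
    by (simp add: transpose_def vec_eq_iff)
  then show "sym_sandwich 0 P Y = 0" "sym_sandwich X 0 Y = 0" "sym_sandwich X P 0 = 0"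
    by (simp_all add: sym_sandwich_def matrix_mult.zero_left matrix_mult.zero_right)
qed

lemma transpose_uminus: "transpose (- X) = - transpose (X :: real^'n^'m)"
  by (simp add: transpose_def vec_eq_iff)

lemma sym_sandwich_minus:
  "sym_sandwich (- X) P Y = - sym_sandwich X P Y" "sym_sandwich X P (- Y) = - sym_sandwich X P Y"
  by (simp_all add: sym_sandwich_def transpose_uminus matrix_mult.minus_left matrix_mult.minus_right)

lemma has_derivative_lyap_sandwich:
  fixes Ac F :: "'a::real_normed_vector \<Rightarrow> real^'n^'n"
  assumes "schur_stable (Ac k)"
    and "(Ac has_derivative dA) (at k)" and "(F has_derivative dF) (at k)"
    and "\<And>h. dG h = dF h + sym_sandwich (dA h) (lyap (Ac k) (F k)) (Ac k)"
  shows "((\<lambda>y. lyap (Ac y) (F y)) has_derivative (\<lambda>h. lyap (Ac k) (dG h))) (at k)"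
  using has_derivative_lyap[of Ac k dA F dF] assms by (simp add: sym_sandwich_def add.assoc)

locale sof =
  fixes A :: "real^'n^'n" and B :: "real^'m^'n" and C :: "real^'n^'d"
    and Q :: "real^'n^'n" and R :: "real^'m^'m"
  assumes Q: "sym_pos_def Q" and R: "sym_pos_def R"
begin

abbreviation cl :: "real^'d^'m \<Rightarrow> real^'n^'n" where
  "cl K \<equiv> closed_loop A B C K"

definition BC :: "real^'d^'m \<Rightarrow> real^'n^'n" where
  "BC Z = B ** Z ** C"

definition stage :: "real^'d^'m \<Rightarrow> real^'n^'n" where
  "stage K = Q + transpose C ** transpose K ** R ** K ** C"

definition P :: "real^'d^'m \<Rightarrow> real^'n^'n" where
  "P K = lyap (cl K) (stage K)"

text \<open>\<open>P1 K\<close>, \<open>P2 K\<close>, \<open>P3 K\<close> are the first three derivatives of \<open>P\<close> at \<open>K\<close>, as multilinear functions of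
  the directions \<open>Z\<close>, \<open>W\<close>, \<open>V\<close>; \<open>- BC Z\<close> is the derivative of the closed loop.\<close>

definition F1 :: "real^'d^'m \<Rightarrow> real^'d^'m \<Rightarrow> real^'n^'n" where
  "F1 K Z = sym_sandwich (Z ** C) R (K ** C) - sym_sandwich (BC Z) (P K) (cl K)"

definition P1 :: "real^'d^'m \<Rightarrow> real^'d^'m \<Rightarrow> real^'n^'n" where
  "P1 K Z = lyap (cl K) (F1 K Z)"

definition F2 :: "real^'d^'m \<Rightarrow> real^'d^'m \<Rightarrow> real^'d^'m \<Rightarrow> real^'n^'n" where
  "F2 K Z W = sym_sandwich (Z ** C) R (W ** C) + sym_sandwich (BC Z) (P K) (BC W)
    - sym_sandwich (BC Z) (P1 K W) (cl K) - sym_sandwich (BC W) (P1 K Z) (cl K)"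

definition P2 :: "real^'d^'m \<Rightarrow> real^'d^'m \<Rightarrow> real^'d^'m \<Rightarrow> real^'n^'n" where
  "P2 K Z W = lyap (cl K) (F2 K Z W)"

text \<open>\<open>stage\<close> is quadratic in the gain, so \<open>R\<close> has disappeared. In
  the first three terms each direction takes its turn in the middle factor, in the last three each
  takes its turn in the outer one.\<close>

definition F3 :: "real^'d^'m \<Rightarrow> real^'d^'m \<Rightarrow> real^'d^'m \<Rightarrow> real^'d^'m \<Rightarrow> real^'n^'n" where
  "F3 K Z W V = sym_sandwich (BC Z) (P1 K V) (BC W) + sym_sandwich (BC Z) (P1 K W) (BC V)
    + sym_sandwich (BC W) (P1 K Z) (BC V) - sym_sandwich (BC Z) (P2 K W V) (cl K)
    - sym_sandwich (BC W) (P2 K Z V) (cl K) - sym_sandwich (BC V) (P2 K Z W) (cl K)"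

definition P3 :: "real^'d^'m \<Rightarrow> real^'d^'m \<Rightarrow> real^'d^'m \<Rightarrow> real^'d^'m \<Rightarrow> real^'n^'n" where
  "P3 K Z W V = lyap (cl K) (F3 K Z W V)"

lemma sym_R: "transpose R = R" and sym_Q: "transpose Q = Q"
  using Q R by (simp_all add: sym_pos_def_def)

lemma has_derivative_cl [derivative_intros]: "(cl has_derivative (\<lambda>H. - BC H)) (at K)"
  unfolding closed_loop_def BC_def
  by (rule has_derivative_eq_rhs, (rule derivative_intros)+)
     (simp add: fun_eq_iff matrix_mult.zero_left matrix_mult.zero_right)

lemma stage_eq: "stage K = Q + transpose (K ** C) ** R ** (K ** C)"
  by (simp add: stage_def matrix_transpose_mul matrix_mul_assoc)

lemma has_derivative_mult_C [derivative_intros]: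
  "((\<lambda>K. K ** C) has_derivative (\<lambda>H. H ** C)) (at K)"
  by (rule bounded_linear_imp_has_derivative) (rule matrix_mult.bounded_linear_left)

lemma has_derivative_stage:
  "(stage has_derivative (\<lambda>H. sym_sandwich (H ** C) R (K ** C))) (at K)"
  unfolding stage_eq
  by (rule has_derivative_eq_rhs, (rule derivative_intros)+)
     (simp add: fun_eq_iff sym_sandwich_def matrix_mult.zero_left matrix_mult.zero_right add.commute)

lemma stage_form:
  "x \<bullet> (stage K *v x) = x \<bullet> (Q *v x) + ((K ** C) *v x) \<bullet> (R *v ((K ** C) *v x))"
  by (simp add: stage_eq matrix_vector_mult_add_rdistrib inner_add_right
      inner_transpose_matrix matrix_vector_mul_assoc[symmetric] del: transpose_matrix_vector)

lemma sigma_min_le_stage: "sigma_min Q * (norm x)\<^sup>2 \<le> x \<bullet> (stage K *v x)"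
  using sigma_min_le_form[OF Q, of x] sym_pos_def_nonneg[OF R, of "(K ** C) *v x"]
  by (simp add: stage_form)

lemma stage_nonneg: "0 \<le> x \<bullet> (stage K *v x)"
  using sym_pos_def_nonneg[OF Q, of x] sym_pos_def_nonneg[OF R, of "(K ** C) *v x"]
  by (simp add: stage_form)

context
  fixes K assumes stable: "schur_stable (cl K)"
begin

lemma has_derivative_P: "(P has_derivative P1 K) (at K)"
  unfolding P_def[abs_def] P1_def[abs_def]
  by (rule has_derivative_lyap_sandwich[OF stable has_derivative_cl has_derivative_stage])
     (simp add: F1_def P_def sym_sandwich_minus)

lemma has_derivative_P1: "((\<lambda>K. P1 K Z) has_derivative P2 K Z) (at K)"
proof -
  \<comment> \<open>The last sandwich of \<open>F2\<close> is absent here: it comes from the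
    dependence of the Stein operator on the gain and is supplied by
    \<open>has_derivative_lyap_sandwich\<close>.\<close>
  have "((\<lambda>K. F1 K Z) has_derivative
      (\<lambda>W. sym_sandwich (Z ** C) R (W ** C) + sym_sandwich (BC Z) (P K) (BC W)
        - sym_sandwich (BC Z) (P1 K W) (cl K))) (at K)"
    unfolding F1_def
    by (rule has_derivative_eq_rhs, (rule derivative_intros has_derivative_P)+)
       (simp add: fun_eq_iff sym_sandwich_minus sym_sandwich_zero)
  then show ?thesis
    unfolding P1_def[abs_def] P2_def[abs_def]
    by (rule has_derivative_lyap_sandwich[OF stable has_derivative_cl])
       (simp add: F2_def P1_def sym_sandwich_minus)
qed

lemma has_derivative_P2: "((\<lambda>K. P2 K Z W) has_derivative P3 K Z W) (at K)"
proof -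
  have "((\<lambda>K. F2 K Z W) has_derivative
      (\<lambda>V. sym_sandwich (BC Z) (P1 K V) (BC W) + sym_sandwich (BC Z) (P1 K W) (BC V)
    + sym_sandwich (BC W) (P1 K Z) (BC V) - sym_sandwich (BC Z) (P2 K W V) (cl K)
    - sym_sandwich (BC W) (P2 K Z V) (cl K))) (at K)"
    unfolding F2_def
    by (rule has_derivative_eq_rhs,
        (rule derivative_intros has_derivative_P has_derivative_P1)+)
       (simp add: fun_eq_iff sym_sandwich_minus sym_sandwich_zero)
  then show ?thesis
    unfolding P2_def[abs_def] P3_def[abs_def]
    by (rule has_derivative_lyap_sandwich[OF stable has_derivative_cl])
       (simp add: F3_def P2_def sym_sandwich_minus)
qed

lemma transpose_P: "transpose (P K) = P K"
  unfolding P_def transpose_lyap[OF stable]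
  by (simp add: stage_eq transpose_add matrix_transpose_mul matrix_mul_assoc sym_Q sym_R)

lemma transpose_P1: "transpose (P1 K Z) = P1 K Z"
  unfolding P1_def transpose_lyap[OF stable]
  by (simp add: F1_def transpose_diff transpose_sym_sandwich sym_R transpose_P)

lemma transpose_P2: "transpose (P2 K Z W) = P2 K Z W"
  unfolding P2_def transpose_lyap[OF stable]
  by (simp add: F2_def transpose_diff transpose_add transpose_sym_sandwich sym_R transpose_P
      transpose_P1)

lemma P_form:
  "x \<bullet> (P K *v x) = x \<bullet> (stage K *v x) + (cl K *v x) \<bullet> (P K *v (cl K *v x))"
  using stein_form[of x "cl K" "P K" x] by (simp add: P_def stein_lyap[OF stable])

lemma P_nonneg: "0 \<le> x \<bullet> (P K *v x)"
  unfolding P_def by (rule lyap_nonneg[OF stable stage_nonneg])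

text \<open>\<open>P_form\<close> is the Bellman identity, so the value cannot increase along a
  trajectory: relative to \<open>P K\<close> the closed loop is a contraction even if its induced
  norm exceeds 1.\<close>

lemma P_cl_le: "(cl K *v x) \<bullet> (P K *v (cl K *v x)) \<le> x \<bullet> (P K *v x)"
  using P_form[of x] stage_nonneg[of x K] by simp

end

section \<open>Bounds on the first three derivatives at one gain\<close>

context
  fixes K :: "real^'d^'m" and \<sigma> p \<gamma> b r :: real
  assumes stable: "schur_stable (cl K)"
    and P_le: "\<And>x. x \<bullet> (P K *v x) \<le> p * (norm x)\<^sup>2"
    and \<gamma>: "norm2 (cl K) \<le> \<gamma>"
  defines "\<sigma> \<equiv> sigma_min Q" and "b \<equiv> norm2 B * norm2 C" and "r \<equiv> norm2 R * (norm2 C)\<^sup>2"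
begin

lemma sigma_pos: "0 < \<sigma>"
  unfolding \<sigma>_def by (rule sigma_min_pos[OF Q])

lemma b_nonneg: "0 \<le> b" and r_nonneg: "0 \<le> r"
  by (simp_all add: b_def r_def norm2_nonneg)

lemma \<gamma>_nonneg: "0 \<le> \<gamma>"
  using norm2_nonneg \<gamma> by (rule order_trans)

lemma stage_ge: "\<sigma> * (norm x)\<^sup>2 \<le> x \<bullet> (stage K *v x)"
  unfolding \<sigma>_def by (rule sigma_min_le_stage)

lemma sigma_le_p: "\<sigma> \<le> p"
proof -
  obtain e :: "real^'n" where e: "norm e = 1"
    using norm_axis_1 by blast
  show ?thesis
    using stage_ge[of e] P_form[OF stable, of e] P_le[of e] P_nonneg[OF stable, of "cl K *v e"] by (simp add: e)
qed

lemma p_nonneg: "0 \<le> p"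
  using sigma_pos sigma_le_p by simp

lemma norm_mult_C_le: "norm ((Z ** C) *v x) \<le> norm2 C * norm Z * norm x"
proof -
  have "norm ((Z ** C) *v x) \<le> norm Z * norm (C *v x)"
    unfolding matrix_vector_mul_assoc[symmetric] by (rule norm_matrix_vector_le)
  also have "\<dots> \<le> norm Z * (norm2 C * norm x)"
    by (intro mult_left_mono norm_mult_le_norm2) simp
  finally show ?thesis by (simp add: mult_ac)
qed

lemma norm_BC_le: "norm (BC Z *v x) \<le> b * norm Z * norm x"
proof -
  have "norm (BC Z *v x) = norm (B *v ((Z ** C) *v x))"
    by (simp add: BC_def matrix_vector_mul_assoc matrix_mul_assoc)
  also have "\<dots> \<le> norm2 B * norm ((Z ** C) *v x)"
    by (rule norm_mult_le_norm2)
  also have "\<dots> \<le> norm2 B * (norm2 C * norm Z * norm x)"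
    by (intro mult_left_mono norm_mult_C_le norm2_nonneg)
  finally show ?thesis by (simp add: b_def mult_ac)
qed

lemma sqrt_P_le: "sqrt (x \<bullet> (P K *v x)) \<le> sqrt p * norm x"
  using real_sqrt_le_mono[OF P_le[of x]] by (simp add: real_sqrt_mult)

lemma sqrt_P_BC_le:
  "sqrt ((BC Z *v x) \<bullet> (P K *v (BC Z *v x))) \<le> sqrt p * (b * norm Z * norm x)"
  by (rule order_trans[OF sqrt_P_le]) (intro mult_left_mono norm_BC_le real_sqrt_ge_zero p_nonneg)

text \<open>The factor \<gamma> is the norm estimate, the factor 1 the contraction
  \<open>P_cl_le\<close>. The latter frees the third derivative from a further \<gamma>, and
  \<open>P1_constant_le_zeta2\<close> uses both.\<close>

lemma sqrt_P_cl_le: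
  "sqrt ((cl K *v x) \<bullet> (P K *v (cl K *v x))) \<le> sqrt p * (min \<gamma> 1 * norm x)"
proof -
  have "sqrt ((cl K *v x) \<bullet> (P K *v (cl K *v x))) \<le> sqrt p * (\<gamma> * norm x)"
    using \<gamma> norm_mult_le_norm2[of "cl K" x]
    by (intro order_trans[OF sqrt_P_le] mult_left_mono real_sqrt_ge_zero p_nonneg)
       (meson mult_right_mono norm_ge_zero order_trans)
  moreover have "sqrt ((cl K *v x) \<bullet> (P K *v (cl K *v x))) \<le> sqrt p * norm x"
    using real_sqrt_le_mono[OF P_cl_le[OF stable, of x]] sqrt_P_le[of x] by linarith
  ultimately show ?thesis by (simp add: min_def)
qed

lemma dominated_form_le:
  assumes "transpose X = X" and "0 \<le> u" and "\<And>x. \<bar>x \<bullet> (X *v x)\<bar> \<le> u * (x \<bullet> (P K *v x))"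
    and "sqrt (y \<bullet> (P K *v y)) \<le> sqrt p * c" and "sqrt (z \<bullet> (P K *v z)) \<le> sqrt p * d"
  shows "\<bar>y \<bullet> (X *v z)\<bar> \<le> u * (p * (c * d))"
proof -
  have "\<bar>y \<bullet> (X *v z)\<bar> \<le> u * (sqrt (y \<bullet> (P K *v y)) * sqrt (z \<bullet> (P K *v z)))"
    by (rule dominated_form_Cauchy_Schwarz[OF assms(1,2) P_nonneg[OF stable] assms(3)])
  also have "\<dots> \<le> u * ((sqrt p * c) * (sqrt p * d))"
    using assms(2,4,5) P_nonneg[OF stable]
    by (intro mult_left_mono mult_mono) (auto intro: order_trans[OF real_sqrt_ge_zero])
  also have "(sqrt p * c) * (sqrt p * d) = p * (c * d)"
    using real_sqrt_mult_self[of p] p_nonneg by (simp add: mult_ac)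
  finally show ?thesis .
qed

lemmas P_form_le = dominated_form_le[OF transpose_P[OF stable] zero_le_one, simplified, OF P_nonneg[OF stable]]

text \<open>Origin of the division by \<sigma>: |x|^2 is at most 1/\<sigma> times the stage cost,
  after which \<open>lyap_dominated\<close> applies.\<close>

lemma lyap_le_if_quadratic:
  assumes "\<And>x. \<bar>x \<bullet> (F *v x)\<bar> \<le> c * (norm x)\<^sup>2" and "0 \<le> c"
  shows "\<bar>x \<bullet> (lyap (cl K) F *v x)\<bar> \<le> c / \<sigma> * (x \<bullet> (P K *v x))"
  unfolding P_def
proof (rule lyap_dominated[OF stable])
  fix x :: "real^'n"
  have "c * (norm x)\<^sup>2 = c / \<sigma> * (\<sigma> * (norm x)\<^sup>2)"
    using sigma_pos by simp
  also have "\<dots> \<le> c / \<sigma> * (x \<bullet> (stage K *v x))"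
    using sigma_pos assms(2) by (intro mult_left_mono stage_ge) simp
  finally show "\<bar>x \<bullet> (F *v x)\<bar> \<le> c / \<sigma> * (x \<bullet> (stage K *v x))"
    using assms(1)[of x] by simp
qed

lemma sqrt_R_le: "sqrt (((Z ** C) *v x) \<bullet> (R *v ((Z ** C) *v x))) \<le> sqrt r * (norm Z * norm x)"
proof -
  define y where "y = (Z ** C) *v x"
  have "y \<bullet> (R *v y) \<le> norm2 R * (norm y)\<^sup>2"
    using abs_form_le_norm2[of y R y] by (simp add: power2_eq_square)
  also have "\<dots> \<le> norm2 R * (norm2 C * norm Z * norm x)\<^sup>2"
    unfolding y_def by (intro mult_left_mono power_mono norm_mult_C_le norm2_nonneg norm_ge_zero)
  also have "\<dots> = r * (norm Z * norm x)\<^sup>2"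
    by (simp add: r_def power_mult_distrib)
  finally show ?thesis
    using real_sqrt_le_mono by (fastforce simp: real_sqrt_mult y_def)
qed

lemma abs_R_form_le:
  "\<bar>((Z ** C) *v x) \<bullet> (R *v ((W ** C) *v x))\<bar>
    \<le> sqrt r * (norm Z * norm x) * sqrt (((W ** C) *v x) \<bullet> (R *v ((W ** C) *v x)))"
  by (rule order_trans[OF symmetric_form_Cauchy_Schwarz[OF sym_R sym_pos_def_nonneg[OF R]]])
     (intro mult_right_mono sqrt_R_le real_sqrt_ge_zero sym_pos_def_nonneg[OF R])

text \<open>\<rho> and \<tau> are kept because the two bounds on \<open>P1\<close> spend them
  differently: one jointly, through the Bellman identity, the other separately.\<close>

lemma abs_F1_form_le:
  fixes x :: "real^'n"
  defines "\<rho> \<equiv> sqrt (((K ** C) *v x) \<bullet> (R *v ((K ** C) *v x)))"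
    and "\<tau> \<equiv> sqrt ((cl K *v x) \<bullet> (P K *v (cl K *v x)))"
  shows "\<bar>x \<bullet> (F1 K Z *v x)\<bar>
    \<le> norm Z * (2 * (sqrt r * norm x) * \<rho> + 2 * (sqrt p * b * norm x) * \<tau>)"
proof -
  have "\<bar>((Z ** C) *v x) \<bullet> (R *v ((K ** C) *v x))\<bar> \<le> sqrt r * (norm Z * norm x) * \<rho>"
    unfolding \<rho>_def by (rule abs_R_form_le)
  moreover have "\<bar>(BC Z *v x) \<bullet> (P K *v (cl K *v x))\<bar> \<le> sqrt p * (b * norm Z * norm x) * \<tau>"
    unfolding \<tau>_def
    by (rule order_trans[OF symmetric_form_Cauchy_Schwarz[OF transpose_P[OF stable] P_nonneg[OF stable]]])
       (intro mult_right_mono sqrt_P_BC_le real_sqrt_ge_zero P_nonneg[OF stable])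
  ultimately show ?thesis
    by (simp add: F1_def matrix_vector_mult_diff_rdistrib inner_diff_right
        sym_sandwich_form[OF sym_R] sym_sandwich_form[OF transpose_P[OF stable]] algebra_simps)
qed

lemma R_form_sqrt:
  "(sqrt (((K ** C) *v x) \<bullet> (R *v ((K ** C) *v x))))\<^sup>2 = x \<bullet> (stage K *v x) - x \<bullet> (Q *v x)"
  using sym_pos_def_nonneg[OF R] by (simp add: stage_form)

text \<open>Using 2 a b \<le> a^2 + b^2 twice leaves \<rho>^2 + \<tau>^2, which by the Bellman
  identity is the form of \<open>P K\<close> minus that of \<open>Q\<close>, at most (p - \<sigma>)
  |x|^2. With p = \<alpha>/\<mu> the coefficient is \<open>\<zeta>\<^sub>1\<close>, whose -1 stems
  from -\<sigma>.\<close>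

lemma P1_le_zeta1:
  "\<bar>x \<bullet> (P1 K Z *v x)\<bar> \<le> (p - \<sigma> + r + b\<^sup>2 * p) / \<sigma> * norm Z * (x \<bullet> (P K *v x))"
proof -
  have "\<bar>x \<bullet> (F1 K Z *v x)\<bar> \<le> norm Z * (p - \<sigma> + r + b\<^sup>2 * p) * (norm x)\<^sup>2" for x
  proof -
    define \<rho> where "\<rho> = sqrt (((K ** C) *v x) \<bullet> (R *v ((K ** C) *v x)))"
    define \<tau> where "\<tau> = sqrt ((cl K *v x) \<bullet> (P K *v (cl K *v x)))"
    have "2 * (sqrt r * norm x) * \<rho> + 2 * (sqrt p * b * norm x) * \<tau>
        \<le> ((sqrt r * norm x)\<^sup>2 + \<rho>\<^sup>2) + ((sqrt p * b * norm x)\<^sup>2 + \<tau>\<^sup>2)"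
      by (intro add_mono sum_squares_bound)
    also have "\<dots> = (r + b\<^sup>2 * p) * (norm x)\<^sup>2 + (\<rho>\<^sup>2 + \<tau>\<^sup>2)"
      using r_nonneg p_nonneg by (simp add: power_mult_distrib algebra_simps)
    also have "\<rho>\<^sup>2 + \<tau>\<^sup>2 \<le> (p - \<sigma>) * (norm x)\<^sup>2"
      using P_form[OF stable, of x] P_le[of x] P_nonneg[OF stable, of "cl K *v x"] sigma_min_le_form[OF Q, of x]
      unfolding \<rho>_def R_form_sqrt by (simp add: \<tau>_def \<sigma>_def algebra_simps)
    finally have "norm Z * (2 * (sqrt r * norm x) * \<rho> + 2 * (sqrt p * b * norm x) * \<tau>)
        \<le> norm Z * ((r + b\<^sup>2 * p) * (norm x)\<^sup>2 + (p - \<sigma>) * (norm x)\<^sup>2)"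
      by (intro mult_left_mono) simp_all
    with abs_F1_form_le[of x Z] show ?thesis
      unfolding \<rho>_def \<tau>_def by (simp add: algebra_simps)
  qed
  then have "\<bar>x \<bullet> (P1 K Z *v x)\<bar> \<le> norm Z * (p - \<sigma> + r + b\<^sup>2 * p) / \<sigma> * (x \<bullet> (P K *v x))"
    unfolding P1_def using sigma_le_p r_nonneg p_nonneg
    by (intro lyap_le_if_quadratic) auto
  then show ?thesis by (simp add: mult_ac)
qed

text \<open>The \<open>R\<close> term is compared with the whole stage cost instead of |x|^2:
  \<sigma> |x|^2 and \<rho>^2 together fit into it, so the weight sqrt \<sigma> is moved onto |x|
  before 2 a b \<le> a^2 + b^2 is used.\<close>

lemma P1_le_zeta2:
  "\<bar>x \<bullet> (P1 K Z *v x)\<bar>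
    \<le> (sqrt (r / \<sigma>) + 2 * b * p * min \<gamma> 1 / \<sigma>) * norm Z * (x \<bullet> (P K *v x))"
  unfolding P1_def P_def
proof (rule lyap_dominated[OF stable])
  fix x :: "real^'n"
  define \<rho> where "\<rho> = sqrt (((K ** C) *v x) \<bullet> (R *v ((K ** C) *v x)))"
  define \<tau> where "\<tau> = sqrt ((cl K *v x) \<bullet> (P K *v (cl K *v x)))"
  define s where "s = x \<bullet> (stage K *v x)"
  have "2 * (sqrt r * norm x) * \<rho> = sqrt (r / \<sigma>) * (2 * (sqrt \<sigma> * norm x) * \<rho>)"
    using sigma_pos by (simp add: real_sqrt_divide)
  also have "\<dots> \<le> sqrt (r / \<sigma>) * ((sqrt \<sigma> * norm x)\<^sup>2 + \<rho>\<^sup>2)"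
    using sigma_pos r_nonneg by (intro mult_left_mono sum_squares_bound) simp
  also have "\<dots> \<le> sqrt (r / \<sigma>) * s"
    using sigma_pos r_nonneg sigma_min_le_form[OF Q, of x]
    by (intro mult_left_mono) (simp_all add: \<rho>_def R_form_sqrt s_def power_mult_distrib \<sigma>_def)
  finally have 1: "2 * (sqrt r * norm x) * \<rho> \<le> sqrt (r / \<sigma>) * s" .
  have "2 * (sqrt p * b * norm x) * \<tau> \<le> 2 * (sqrt p * b * norm x) * (sqrt p * (min \<gamma> 1 * norm x))"
    unfolding \<tau>_def using p_nonneg b_nonneg by (intro mult_left_mono sqrt_P_cl_le) simp
  also have "\<dots> = 2 * b * (sqrt p * sqrt p) * min \<gamma> 1 * (norm x)\<^sup>2"
    by (simp only: power2_eq_square mult_ac)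
  also have "\<dots> = 2 * b * p * min \<gamma> 1 / \<sigma> * (\<sigma> * (norm x)\<^sup>2)"
    using sigma_pos p_nonneg by simp
  also have "\<dots> \<le> 2 * b * p * min \<gamma> 1 / \<sigma> * s"
    unfolding s_def using sigma_pos p_nonneg b_nonneg \<gamma>_nonneg
    by (intro mult_left_mono stage_ge) simp
  finally have "norm Z * (2 * (sqrt r * norm x) * \<rho> + 2 * (sqrt p * b * norm x) * \<tau>)
      \<le> norm Z * (sqrt (r / \<sigma>) * s + 2 * b * p * min \<gamma> 1 / \<sigma> * s)"
    by (intro mult_left_mono add_mono 1) simp_all
  with abs_F1_form_le[of x Z]
  show "\<bar>x \<bullet> (F1 K Z *v x)\<bar> \<le> (sqrt (r / \<sigma>) + 2 * b * p * min \<gamma> 1 / \<sigma>) * norm Z * (x \<bullet> (stage K *v x))"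
    unfolding \<rho>_def \<tau>_def s_def by (simp add: algebra_simps)
qed

context
  fixes U :: real
  assumes U: "0 \<le> U"
    and P1_le: "\<And>Z x. \<bar>x \<bullet> (P1 K Z *v x)\<bar> \<le> U * norm Z * (x \<bullet> (P K *v x))"
begin

text \<open>\<open>U\<close> stays a parameter so that the smaller of the two bounds on
  \<open>P1\<close> can be inserted. The two cross terms with \<open>P1\<close>, each doubled by its
  sandwich, give the factor 4.\<close>

lemma P2_le:
  "\<bar>x \<bullet> (P2 K Z W *v x)\<bar>
    \<le> (2 * (r + b\<^sup>2 * p) + 4 * b * p * \<gamma> * U) / \<sigma> * (norm Z * norm W) * (x \<bullet> (P K *v x))"
proof -
  have "\<bar>x \<bullet> (F2 K Z W *v x)\<bar>
      \<le> (2 * (r + b\<^sup>2 * p) + 4 * b * p * \<gamma> * U) * (norm Z * norm W) * (norm x)\<^sup>2" for x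
  proof -
    have "\<bar>((Z ** C) *v x) \<bullet> (R *v ((W ** C) *v x))\<bar>
        \<le> sqrt r * (norm Z * norm x) * (sqrt r * (norm W * norm x))"
      by (rule order_trans[OF abs_R_form_le])
         (intro mult_left_mono sqrt_R_le mult_nonneg_nonneg real_sqrt_ge_zero r_nonneg norm_ge_zero)
    also have "\<dots> = (sqrt r * sqrt r) * (norm Z * norm W * (norm x)\<^sup>2)"
      by (simp only: power2_eq_square mult_ac)
    finally have 1: "\<bar>((Z ** C) *v x) \<bullet> (R *v ((W ** C) *v x))\<bar> \<le> r * (norm Z * norm W * (norm x)\<^sup>2)"
      using r_nonneg by simp
    have 2: "\<bar>(BC Z *v x) \<bullet> (P K *v (BC W *v x))\<bar> \<le> b\<^sup>2 * p * (norm Z * norm W * (norm x)\<^sup>2)"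
      using P_form_le[OF sqrt_P_BC_le sqrt_P_BC_le, of Z x W x]
      by (simp add: power2_eq_square mult_ac)
    have 3: "\<bar>(BC Z *v x) \<bullet> (P1 K W *v (cl K *v x))\<bar> \<le> b * p * \<gamma> * U * (norm Z * norm W * (norm x)\<^sup>2)"
      for Z W
    proof -
      have "\<bar>(BC Z *v x) \<bullet> (P1 K W *v (cl K *v x))\<bar>
          \<le> U * norm W * (p * ((b * norm Z * norm x) * (min \<gamma> 1 * norm x)))"
        using U by (intro dominated_form_le P1_le transpose_P1[OF stable] sqrt_P_BC_le sqrt_P_cl_le) simp
      also have "\<dots> \<le> U * norm W * (p * ((b * norm Z * norm x) * (\<gamma> * norm x)))"
        using U p_nonneg b_nonneg by (intro mult_left_mono mult_right_mono) simp_all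
      finally show ?thesis by (simp add: power2_eq_square mult_ac)
    qed
    show ?thesis
      using 1 2 3[of Z W] 3[of W Z]
      by (simp add: F2_def matrix_vector_mult_diff_rdistrib matrix_vector_mult_add_rdistrib
        inner_diff_right inner_add_right sym_sandwich_form[OF sym_R] sym_sandwich_form[OF transpose_P[OF stable]]
        sym_sandwich_form[OF transpose_P1[OF stable]] algebra_simps)
  qed
  then have "\<bar>x \<bullet> (P2 K Z W *v x)\<bar>
      \<le> (2 * (r + b\<^sup>2 * p) + 4 * b * p * \<gamma> * U) * (norm Z * norm W) / \<sigma> * (x \<bullet> (P K *v x))"
    unfolding P2_def using r_nonneg p_nonneg b_nonneg U \<gamma>_nonneg
    by (intro lyap_le_if_quadratic) simp_all
  then show ?thesis by (simp add: mult_ac)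
qed

text \<open>Three sandwiches with \<open>P1\<close> and three with \<open>P2\<close>, each doubled,
  give the two factors 6. The closed loop enters with weight 1, since \<open>M\<close> has no
  \<gamma> beside \<open>\<zeta>\<^sub>3\<close> and \<open>\<zeta>\<^sub>4\<close>.\<close>

lemma P3_le:
  assumes U2: "0 \<le> U2"
    and P2_le: "\<And>Z W x. \<bar>x \<bullet> (P2 K Z W *v x)\<bar> \<le> U2 * (norm Z * norm W) * (x \<bullet> (P K *v x))"
  shows "\<bar>x \<bullet> (P3 K Z W V *v x)\<bar>
    \<le> (6 * b * p * U2 + 6 * b\<^sup>2 * p * U) / \<sigma> * (norm Z * norm W * norm V) * (x \<bullet> (P K *v x))"
proof -
  have "\<bar>x \<bullet> (F3 K Z W V *v x)\<bar>
      \<le> (6 * b * p * U2 + 6 * b\<^sup>2 * p * U) * (norm Z * norm W * norm V) * (norm x)\<^sup>2" for x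
  proof -
    define n where "n = norm Z * norm W * norm V * (norm x)\<^sup>2"
    have 1: "\<bar>(BC X *v x) \<bullet> (P1 K Y *v (BC Y' *v x))\<bar> \<le> b\<^sup>2 * p * U * (norm X * norm Y * norm Y' * (norm x)\<^sup>2)"
      for X Y Y'
    proof -
      have "\<bar>(BC X *v x) \<bullet> (P1 K Y *v (BC Y' *v x))\<bar>
          \<le> U * norm Y * (p * ((b * norm X * norm x) * (b * norm Y' * norm x)))"
        using U by (intro dominated_form_le P1_le transpose_P1[OF stable] sqrt_P_BC_le) simp
      then show ?thesis by (simp add: power2_eq_square mult_ac)
    qed
    have 2: "\<bar>(BC X *v x) \<bullet> (P2 K Y Y' *v (cl K *v x))\<bar> \<le> b * p * U2 * (norm X * norm Y * norm Y' * (norm x)\<^sup>2)"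
      for X Y Y'
    proof -
      have "\<bar>(BC X *v x) \<bullet> (P2 K Y Y' *v (cl K *v x))\<bar>
          \<le> U2 * (norm Y * norm Y') * (p * ((b * norm X * norm x) * (min \<gamma> 1 * norm x)))"
        using U2 by (intro dominated_form_le P2_le transpose_P2[OF stable] sqrt_P_BC_le sqrt_P_cl_le) simp
      also have "\<dots> \<le> U2 * (norm Y * norm Y') * (p * ((b * norm X * norm x) * (1 * norm x)))"
        using U2 p_nonneg b_nonneg by (intro mult_left_mono mult_right_mono) simp_all
      finally show ?thesis by (simp add: power2_eq_square mult_ac)
    qed
    have "\<bar>x \<bullet> (F3 K Z W V *v x)\<bar> \<le> 2 * (3 * (b\<^sup>2 * p * U * n)) + 2 * (3 * (b * p * U2 * n))"
      using 1[of Z V W] 1[of Z W V] 1[of W Z V] 2[of Z W V] 2[of W Z V] 2[of V Z W]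
      by (simp add: F3_def matrix_vector_mult_diff_rdistrib matrix_vector_mult_add_rdistrib
        inner_diff_right inner_add_right sym_sandwich_form[OF transpose_P2[OF stable]]
        sym_sandwich_form[OF transpose_P1[OF stable]] n_def mult_ac)
    then show ?thesis by (simp add: n_def algebra_simps)
  qed
  then have "\<bar>x \<bullet> (P3 K Z W V *v x)\<bar>
      \<le> (6 * b * p * U2 + 6 * b\<^sup>2 * p * U) * (norm Z * norm W * norm V) / \<sigma> * (x \<bullet> (P K *v x))"
    unfolding P3_def using p_nonneg b_nonneg U U2
    by (intro lyap_le_if_quadratic) simp_all
  then show ?thesis by (simp add: mult_ac)
qed

end

end

end


section \<open>The Hessian of the cost\<close>

lemma norm_unvectorize: "norm (unvectorize v) = norm (v :: real^('d::finite \<times> 'm::finite))"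
proof -
  have "(\<Sum>i\<in>UNIV. \<Sum>j\<in>UNIV. (v $ (j, i))\<^sup>2) = (\<Sum>j\<in>UNIV. \<Sum>i\<in>UNIV. (v $ (j, i))\<^sup>2)"
    by (rule sum.swap)
  also have "\<dots> = (\<Sum>q\<in>UNIV. (v $ q)\<^sup>2)"
    by (simp add: sum.cartesian_product)
  finally show ?thesis
    by (simp add: frobenius_norm_eq_norm[symmetric] frobenius_norm_def unvectorize_def
        norm_vec_def[of v] L2_set_def)
qed

lemma bounded_linear_unvectorize:
  "bounded_linear (unvectorize :: real^('d::finite \<times> 'm::finite) \<Rightarrow> real^'d^'m)"
proof -
  have "linear (unvectorize :: real^('d::finite \<times> 'm::finite) \<Rightarrow> real^'d^'m)"
    by (auto intro!: linearI simp: unvectorize_def vec_eq_iff)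
  then show ?thesis by (simp add: linear_conv_bounded_linear)
qed

text \<open>Origin of sqrt(md): the squared Frobenius norm is a sum over the columns.\<close>

lemma frobenius_norm_le_columns:
  fixes N :: "real^'k^'k"
  assumes "0 \<le> c" and "\<And>j. norm (N *v axis j 1) \<le> c"
  shows "frobenius_norm N \<le> sqrt (real CARD('k)) * c"
proof -
  have "(\<Sum>i\<in>UNIV. (N $ i $ j)\<^sup>2) = (norm (N *v axis j 1))\<^sup>2" for j
    by (simp add: norm_vec_def L2_set_def sum_nonneg matrix_vector_mult_basis column_def)
  then have "(frobenius_norm N)\<^sup>2 = (\<Sum>j\<in>UNIV. (norm (N *v axis j 1))\<^sup>2)"
    unfolding frobenius_norm_def by (subst sum.swap) (simp add: sum_nonneg)
  also have "\<dots> \<le> (\<Sum>j\<in>(UNIV :: 'k set). c\<^sup>2)"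
    by (intro sum_mono power_mono assms) simp
  also have "\<dots> = (sqrt (real CARD('k)) * c)\<^sup>2"
    by (simp add: power_mult_distrib)
  finally show ?thesis
    using assms(1) by (rule power2_le_imp_le[OF _ mult_nonneg_nonneg[OF real_sqrt_ge_zero[OF of_nat_0_le_iff]]])
qed

lemma grad_eqI:
  assumes "(f has_derivative f') (at x)"
  shows "grad f x = (\<chi> i. f' (axis i 1))"
  by (simp add: grad_def frechet_derivative_at[OF assms, symmetric])

lemma hessian_eqI:
  assumes "(grad f has_derivative g') (at x)"
  shows "hessian f x = matrix g'"
  by (simp add: hessian_def jacobian_def frechet_derivative_at[OF assms, symmetric])

lemma has_derivative_vec_lambda:
  fixes f :: "'a::real_normed_vector \<Rightarrow> 'k::finite \<Rightarrow> real"
  assumes "\<And>i. ((\<lambda>x. f x i) has_derivative (\<lambda>h. f' h i)) (at a)"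
  shows "((\<lambda>x. \<chi> i. f x i) has_derivative (\<lambda>h. \<chi> i. f' h i)) (at a)"
  by (subst has_derivative_componentwise_within) (auto simp: Basis_vec_def inner_axis assms)

context sof
begin

lemma P2_commute: "P2 K Z W = P2 K W Z"
proof -
  have "F2 K Z W = F2 K W Z"
    unfolding F2_def sym_sandwich_commute[of "Z ** C" R] sym_sandwich_commute[of "BC Z" "P K"]
    by (simp add: algebra_simps)
  then show ?thesis by (simp add: P2_def)
qed

text \<open>In its last direction \<open>P2\<close> is a Frechet derivative, hence linear; symmetry
  carries this over to the other direction.\<close>

lemma linear_P2:
  assumes "schur_stable (cl K)"
  shows "linear (\<lambda>Z. P2 K Z W)"
  unfolding P2_commute[of K _ W] using has_derivative_linear[OF has_derivative_P1[OF assms]] .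

lemma hessian_sof_cost:
  fixes v :: "real^('d \<times> 'm)"
  assumes X0: "sym_pos_def (second_moment D)" and stable: "schur_stable (cl (unvectorize v))"
  shows "hessian (\<lambda>v. sof_cost A B C Q R D (unvectorize v)) v $ i $ j =
    P2 (unvectorize v) (unvectorize (axis i 1)) (unvectorize (axis j 1)) \<bullet> second_moment D"
proof -
  define f where "f v = sof_cost A B C Q R D (unvectorize v)" for v :: "real^('d \<times> 'm)"
  \<comment> \<open>The gradient must be known on a neighbourhood before it is differentiated, and
    the formula for the cost is available at stable gains; \<open>U\<close> provides an open set of
    them.\<close>
  define U where "U = {v :: real^('d \<times> 'm). schur_stable (cl (unvectorize v))}"
  note unv = bounded_linear_imp_has_derivative[OF bounded_linear_unvectorize]
  have "continuous_on UNIV (\<lambda>v :: real^('d \<times> 'm). cl (unvectorize v))"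
    by (intro has_derivative_continuous_on[OF has_derivative_compose[OF unv has_derivative_cl]])
  then have "open ((\<lambda>v :: real^('d \<times> 'm). cl (unvectorize v)) -` {M. schur_stable M})"
    by (intro open_vimage open_schur_stable)
  then have open_U: "open U"
    by (simp add: U_def vimage_def)
  have df: "(f has_derivative (\<lambda>h. P1 (unvectorize v) (unvectorize h) \<bullet> second_moment D)) (at v)"
    if "v \<in> U" for v
  proof -
    have "((\<lambda>v. P (unvectorize v) \<bullet> second_moment D) has_derivative
        (\<lambda>h. P1 (unvectorize v) (unvectorize h) \<bullet> second_moment D)) (at v)"
      using that unfolding U_def
      by (intro has_derivative_inner_left has_derivative_compose[OF unv has_derivative_P]) simp
    then show ?thesis
      by (rule has_derivative_transform_within_open[OF _ open_U that])
         (simp add: f_def U_def sof_cost_eq[OF X0] P_def stage_def)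
  qed
  have "v \<in> U" using stable by (simp add: U_def)
  have "((\<lambda>v. \<chi> i. P1 (unvectorize v) (unvectorize (axis i 1)) \<bullet> second_moment D) has_derivative
      (\<lambda>h. \<chi> i. P2 (unvectorize v) (unvectorize (axis i 1)) (unvectorize h) \<bullet> second_moment D)) (at v)"
    by (intro has_derivative_vec_lambda has_derivative_inner_left
        has_derivative_compose[OF unv has_derivative_P1] stable)
  then have "(grad f has_derivative
      (\<lambda>h. \<chi> i. P2 (unvectorize v) (unvectorize (axis i 1)) (unvectorize h) \<bullet> second_moment D)) (at v)"
    by (rule has_derivative_transform_within_open[OF _ open_U \<open>v \<in> U\<close>])
       (simp add: grad_eqI[OF df])
  from hessian_eqI[OF this] show ?thesis
    by (simp add: f_def[abs_def] matrix_def)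
qed

lemma sublevel_schur_stable:
  "K \<in> sof_sublevel A B C Q R D \<alpha> \<Longrightarrow> schur_stable (cl K)"
  by (simp add: sof_sublevel_def stabilizing_def schur_stable_if_spec_rad_less_1)

section \<open>Uniform estimates on a sublevel set and the mean value theorem\<close>

context
  fixes D :: "(real^'n) measure" and \<alpha> \<mu> :: real
  assumes X0: "sym_pos_def (second_moment D)"
  defines "\<mu> \<equiv> sigma_min (second_moment D)"
begin

lemma sublevel_P_inner:
  assumes "K \<in> sof_sublevel A B C Q R D \<alpha>"
  shows "P K \<bullet> second_moment D \<le> \<alpha>"
  using assms sof_cost_eq[OF X0 sublevel_schur_stable[OF assms]]
  by (simp add: sof_sublevel_def P_def stage_def)

lemmas sublevel_P_nonneg = P_nonneg[OF sublevel_schur_stable]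

lemma sublevel_P_le:
  assumes "K \<in> sof_sublevel A B C Q R D \<alpha>"
  shows "x \<bullet> (P K *v x) \<le> \<alpha> / \<mu> * (norm x)\<^sup>2"
proof -
  have \<mu>: "0 < \<mu>" unfolding \<mu>_def by (rule sigma_min_pos[OF X0])
  have "\<mu> * (x \<bullet> (P K *v x)) \<le> (P K \<bullet> second_moment D) * (norm x)\<^sup>2"
    unfolding \<mu>_def
    by (rule form_le_inner_moment[OF X0 transpose_P[OF sublevel_schur_stable[OF assms]]
          sublevel_P_nonneg[OF assms]])
  also have "\<dots> \<le> \<alpha> * (norm x)\<^sup>2"
    by (intro mult_right_mono sublevel_P_inner assms) simp
  finally show ?thesis using \<mu> by (simp add: pos_le_divide_eq mult.commute)
qed

text \<open>Its purpose is to make the supremum \<gamma> an upper bound. \<open>sigma_min R\<close>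
  controls |K C x| through the stage cost, hence through the value.\<close>

lemma sublevel_norm2_cl_le:
  assumes "K \<in> sof_sublevel A B C Q R D \<alpha>"
  shows "norm2 (cl K) \<le> norm2 A + norm2 B * sqrt (\<alpha> / \<mu> / sigma_min R)"
  unfolding norm2_def[of "cl K"]
proof (rule onorm_le)
  fix x :: "real^'n"
  have pos: "0 < sigma_min R" by (rule sigma_min_pos[OF R])
  define y where "y = (K ** C) *v x"
  have "sigma_min R * (norm y)\<^sup>2 \<le> y \<bullet> (R *v y)"
    by (rule sigma_min_le_form[OF R])
  also have "\<dots> \<le> x \<bullet> (P K *v x)"
    using P_form[OF sublevel_schur_stable[OF assms], of x] sym_pos_def_nonneg[OF Q, of x]
      sublevel_P_nonneg[OF assms, of "cl K *v x"]
    by (simp add: stage_form y_def)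
  also have "\<dots> \<le> \<alpha> / \<mu> * (norm x)\<^sup>2"
    by (rule sublevel_P_le[OF assms])
  finally have "(norm y)\<^sup>2 \<le> \<alpha> / \<mu> * (norm x)\<^sup>2 / sigma_min R"
    unfolding pos_le_divide_eq[OF pos] by (subst mult.commute)
  then have "norm y \<le> sqrt (\<alpha> / \<mu> * (norm x)\<^sup>2 / sigma_min R)"
    by (rule real_le_rsqrt)
  also have "\<dots> = sqrt (\<alpha> / \<mu> / sigma_min R) * norm x"
    by (simp add: real_sqrt_mult real_sqrt_divide)
  finally have y: "norm y \<le> sqrt (\<alpha> / \<mu> / sigma_min R) * norm x" .
  have "cl K *v x = A *v x - B *v y"
    by (simp add: closed_loop_def y_def matrix_vector_mult_diff_rdistrib matrix_vector_mul_assoc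
        matrix_mul_assoc)
  also have "norm \<dots> \<le> norm2 A * norm x + norm2 B * (sqrt (\<alpha> / \<mu> / sigma_min R) * norm x)"
    by (intro norm_triangle_le_diff add_mono norm_mult_le_norm2
        order_trans[OF norm_mult_le_norm2 mult_left_mono[OF y norm2_nonneg]])
  finally show "norm (cl K *v x) \<le> (norm2 A + norm2 B * sqrt (\<alpha> / \<mu> / sigma_min R)) * norm x"
    by (simp add: algebra_simps)
qed

lemma sublevel_norm2_cl_le_SUP:
  assumes "K \<in> sof_sublevel A B C Q R D \<alpha>"
  shows "norm2 (cl K) \<le> (SUP L \<in> sof_sublevel A B C Q R D \<alpha>. norm2 (cl L))"
  by (rule cSUP_upper[OF assms bdd_aboveI2[OF sublevel_norm2_cl_le]])

text \<open>Whole columns are bounded, which costs sqrt(md), whereas a bound on single entries would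
  cost md. A column \<open>w\<close> of the difference is tested against itself: its squared norm is
  then an increment of \<open>P2\<close>, paired with the second moment, between the ends of the
  segment.\<close>

lemma hessian_lipschitz:
  assumes c: "0 \<le> c"
    and seg: "closed_segment K K' \<subseteq> sof_sublevel A B C Q R D \<alpha>"
    and P3: "\<And>L Z W V x. L \<in> sof_sublevel A B C Q R D \<alpha> \<Longrightarrow>
      \<bar>x \<bullet> (P3 L Z W V *v x)\<bar> \<le> c * (norm Z * norm W * norm V) * (x \<bullet> (P L *v x))"
  shows "frobenius_norm (hessian (\<lambda>v. sof_cost A B C Q R D (unvectorize v)) (vectorize K')
      - hessian (\<lambda>v. sof_cost A B C Q R D (unvectorize v)) (vectorize K))
    \<le> sqrt (real CARD('d \<times> 'm)) * (c * \<alpha> * norm (K' - K))"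
proof (rule frobenius_norm_le_columns)
  define X where "X = second_moment D"
  have K: "K \<in> sof_sublevel A B C Q R D \<alpha>" "K' \<in> sof_sublevel A B C Q R D \<alpha>"
    using seg by auto
  have "0 \<le> P K \<bullet> X"
    using inner_moment_mono[OF X0, of 0 "P K"] sublevel_P_nonneg[OF K(1)] by (simp add: X_def)
  then have \<alpha>: "0 \<le> \<alpha>"
    using sublevel_P_inner[OF K(1)] by (simp add: X_def)
  then show "0 \<le> c * \<alpha> * norm (K' - K)"
    using c by simp
  have lip: "\<bar>P2 K' Z W \<bullet> X - P2 K Z W \<bullet> X\<bar> \<le> c * \<alpha> * (norm Z * norm W) * norm (K' - K)" for Z W
  proof -
    have "norm (P2 K' Z W \<bullet> X - P2 K Z W \<bullet> X) \<le> c * \<alpha> * (norm Z * norm W) * norm (K' - K)"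
    proof (rule differentiable_bound[where S = "closed_segment K K'"])
      fix L assume "L \<in> closed_segment K K'"
      with seg have L: "L \<in> sof_sublevel A B C Q R D \<alpha>" by blast
      show "((\<lambda>L. P2 L Z W \<bullet> X) has_derivative (\<lambda>V. P3 L Z W V \<bullet> X)) (at L within closed_segment K K')"
        by (rule has_derivative_at_withinI[OF has_derivative_inner_left[OF has_derivative_P2[
                OF sublevel_schur_stable[OF L]]]])
      have "norm (P3 L Z W V \<bullet> X) \<le> c * \<alpha> * (norm Z * norm W) * norm V" for V
      proof -
        have "norm (P3 L Z W V \<bullet> X) \<le> c * (norm Z * norm W * norm V) * (P L \<bullet> X)"
          unfolding X_def real_norm_def by (rule inner_moment_dominated[OF X0 P3[OF L]])
        also have "\<dots> \<le> c * (norm Z * norm W * norm V) * \<alpha>"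
          unfolding X_def using c by (intro mult_left_mono sublevel_P_inner L) simp
        finally show ?thesis by (simp add: mult_ac)
      qed
      then show "onorm (\<lambda>V. P3 L Z W V \<bullet> X) \<le> c * \<alpha> * (norm Z * norm W)"
        by (rule onorm_bound[rotated]) (intro mult_nonneg_nonneg c \<alpha> norm_ge_zero)
    qed simp_all
    then show ?thesis by simp
  qed
  define H where "H K = hessian (\<lambda>v. sof_cost A B C Q R D (unvectorize v)) (vectorize K)" for K
  fix j
  define E where "E = (unvectorize (axis j 1) :: real^'d^'m)"
  define w where "w = (H K' - H K) *v axis j 1"
  \<comment> \<open>Linearity of \<open>P2\<close> recombines the entries of a column into one
    second derivative, in the direction whose vectorization is \<open>w\<close>.\<close>
  have H_inner: "w \<bullet> (H L *v axis j 1) = P2 L (unvectorize w) E \<bullet> X"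
    if "L \<in> sof_sublevel A B C Q R D \<alpha>" for L
  proof -
    note stable = sublevel_schur_stable[OF that]
    have lin: "linear (\<lambda>u. P2 L (unvectorize u) E)"
      using linear_compose[OF bounded_linear.linear[OF bounded_linear_unvectorize] linear_P2[OF stable]]
      by (simp add: o_def)
    have "P2 L (unvectorize w) E \<bullet> X = P2 L (unvectorize (\<Sum>i\<in>UNIV. w $ i *\<^sub>R axis i 1)) E \<bullet> X"
      by (simp add: scalar_mult_eq_scaleR[symmetric] basis_expansion)
    also have "\<dots> = (\<Sum>i\<in>UNIV. w $ i * (P2 L (unvectorize (axis i 1)) E \<bullet> X))"
      by (simp add: linear_sum[OF lin] linear_scale[OF lin] inner_sum_left)
    also have "\<dots> = (\<Sum>i\<in>UNIV. w $ i * (H L *v axis j 1) $ i)"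
      using stable by (simp add: H_def E_def X_def hessian_sof_cost[OF X0] matrix_vector_mult_basis column_def)
    finally show ?thesis by (simp add: inner_vec_def)
  qed
  have "(norm w)\<^sup>2 = w \<bullet> (H K' *v axis j 1) - w \<bullet> (H K *v axis j 1)"
    unfolding power2_norm_eq_inner inner_diff_right[symmetric]
    by (simp add: w_def matrix_vector_mult_diff_rdistrib)
  also have "\<dots> \<le> c * \<alpha> * (norm w * 1) * norm (K' - K)"
    using lip[of "unvectorize w" E] unfolding H_inner[OF K(1)] H_inner[OF K(2)]
    by (simp add: norm_unvectorize E_def norm_axis_1)
  finally have "norm w * norm w \<le> norm w * (c * \<alpha> * norm (K' - K))"
    by (simp add: power2_eq_square mult_ac)
  then have "norm w \<le> c * \<alpha> * norm (K' - K)"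
    using \<alpha> c by (cases "w = 0") simp_all
  then show "norm ((hessian (\<lambda>v. sof_cost A B C Q R D (unvectorize v)) (vectorize K')
      - hessian (\<lambda>v. sof_cost A B C Q R D (unvectorize v)) (vectorize K)) *v axis j 1)
    \<le> c * \<alpha> * norm (K' - K)"
    by (simp add: w_def H_def)
qed

end

end

text \<open>As nR / sR \<ge> 1, the square root in \<psi> alone shows that \<sigma>
  \<open>\<zeta>\<^sub>2\<close> is at least 2 b p \<gamma> + 2 h. Two thirds of the term 2 b p
  min(\<gamma>, 1) are charged to \<gamma>; the last third, with the minimum replaced by 1, goes to
  \<open>h\<close> along with the \<open>R\<close> term.\<close>

lemma P1_constant_le_zeta2:
  fixes nA nB nC nR sR \<sigma> \<mu> \<alpha> \<gamma> :: real
  assumes pos: "0 < \<sigma>" "0 < \<mu>" "0 < sR" and sR: "sR \<le> nR" and nonneg: "0 \<le> nA" "0 \<le> nB" "0 \<le> nC" "0 \<le> \<gamma>"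
    and p: "\<sigma> \<le> \<alpha> / \<mu>"
  defines "\<psi> \<equiv> sqrt (nR * \<alpha> + nB\<^sup>2 * \<alpha>\<^sup>2 / \<mu>) / (sqrt \<mu> * sR) + nB * nA * \<alpha> / (\<mu> * sR)"
  defines "\<zeta>\<^sub>2 \<equiv> 2 * nC / \<sigma> * (\<alpha> * \<gamma> / \<mu> * nB + \<psi> * nR)"
  shows "sqrt (nR * nC\<^sup>2 / \<sigma>) + 2 * (nB * nC) * (\<alpha> / \<mu>) * min \<gamma> 1 / \<sigma> \<le> 2 / 3 * \<zeta>\<^sub>2"
proof -
  define p where "p = \<alpha> / \<mu>"
  define b where "b = nB * nC"
  define r where "r = nR * nC\<^sup>2"
  define h where "h = sqrt (r * p + b\<^sup>2 * p\<^sup>2)"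
  have p0: "0 < p" "\<sigma> \<le> p" using assms(1,9) by (simp_all add: p_def)
  have \<alpha>: "\<alpha> = p * \<mu>" using pos(2) by (simp add: p_def)
  have nR: "0 < nR" using pos(3) sR by simp
  have b: "0 \<le> b" and r: "0 \<le> r" using nonneg nR by (simp_all add: b_def r_def)
  have "sqrt (nR * \<alpha> + nB\<^sup>2 * \<alpha>\<^sup>2 / \<mu>) = sqrt ((nR * p + nB\<^sup>2 * p\<^sup>2) * \<mu>)"
    using pos(2) by (intro arg_cong[where f = sqrt]) (simp add: \<alpha> field_simps power2_eq_square)
  then have "\<psi> = (sqrt (nR * p + nB\<^sup>2 * p\<^sup>2) + nB * nA * p) / sR"
    using pos by (simp add: \<psi>_def real_sqrt_mult add_divide_distrib \<alpha>)
  then have "\<psi> * nR = (sqrt (nR * p + nB\<^sup>2 * p\<^sup>2) + nB * nA * p) * (nR / sR)"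
    by simp
  also have "\<dots> \<ge> (sqrt (nR * p + nB\<^sup>2 * p\<^sup>2) + nB * nA * p) * 1"
    using pos sR nR p0 nonneg by (intro mult_left_mono add_nonneg_nonneg) simp_all
  finally have "sqrt (nR * p + nB\<^sup>2 * p\<^sup>2) \<le> \<psi> * nR"
    using nonneg p0 by (smt (verit) mult_nonneg_nonneg)
  then have "nC * sqrt (nR * p + nB\<^sup>2 * p\<^sup>2) \<le> nC * (\<psi> * nR)"
    using nonneg(3) by (rule mult_left_mono)
  moreover have "nC * sqrt (nR * p + nB\<^sup>2 * p\<^sup>2) = sqrt (nC\<^sup>2 * (nR * p + nB\<^sup>2 * p\<^sup>2))"
    using nonneg(3) by (simp only: real_sqrt_mult real_sqrt_abs abs_of_nonneg)
  moreover have "nC\<^sup>2 * (nR * p + nB\<^sup>2 * p\<^sup>2) = r * p + b\<^sup>2 * p\<^sup>2"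
    by (simp add: r_def b_def algebra_simps power2_eq_square)
  ultimately have h_le: "h \<le> nC * (\<psi> * nR)"
    by (simp add: h_def)
  have "\<sigma> * \<zeta>\<^sub>2 = 2 * (b * p * \<gamma>) + 2 * (nC * (\<psi> * nR))"
    using pos by (simp add: \<zeta>\<^sub>2_def b_def p_def algebra_simps)
  with h_le have \<zeta>2: "2 * (b * p * \<gamma>) + 2 * h \<le> \<sigma> * \<zeta>\<^sub>2"
    by linarith
  have "\<sigma> * sqrt (r / \<sigma>) = sqrt (r * \<sigma>)"
    using pos(1) real_sqrt_mult_self[of \<sigma>] by (simp add: real_sqrt_mult real_sqrt_divide field_simps)
  also have "\<dots> \<le> sqrt (r * p)"
    using p0 r by (simp add: mult_left_mono)
  finally have 1: "\<sigma> * sqrt (r / \<sigma>) \<le> sqrt (r * p)" .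
  have 2: "sqrt (r * p) + 2 / 3 * (b * p) \<le> 4 / 3 * h"
  proof (rule power2_le_imp_le)
    define u where "u = sqrt (r * p)"
    have u: "u\<^sup>2 = r * p" "0 \<le> u" using r p0 by (simp_all add: u_def)
    \<comment> \<open>With v = b p, (u + 2/3 v)^2 + (2/3 u - v)^2 = 13/9 (u^2 + v^2), and 13/9 is
      below (4/3)^2.\<close>
    have "0 \<le> (2 / 3 * u - b * p)\<^sup>2" by simp
    then have "(u + 2 / 3 * (b * p))\<^sup>2 \<le> 13 / 9 * (u\<^sup>2 + (b * p)\<^sup>2)"
      by (simp add: power2_eq_square algebra_simps)
    also have "\<dots> \<le> 16 / 9 * (u\<^sup>2 + (b * p)\<^sup>2)"
      by simp
    also have "\<dots> = (4 / 3 * h)\<^sup>2"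
      using r p0 by (simp add: u h_def power_mult_distrib power_divide)
    finally show "(sqrt (r * p) + 2 / 3 * (b * p))\<^sup>2 \<le> (4 / 3 * h)\<^sup>2"
      by (simp add: u_def)
    show "0 \<le> 4 / 3 * h" using r p0 by (simp add: h_def)
  qed
  have "b * p * min \<gamma> 1 \<le> b * p * \<gamma>" "b * p * min \<gamma> 1 \<le> b * p * 1"
    using b p0 by (intro mult_left_mono; simp)+
  then have "\<sigma> * sqrt (r / \<sigma>) + 2 * (b * p * min \<gamma> 1) \<le> \<sigma> * (2 / 3 * \<zeta>\<^sub>2)"
    using 1 2 \<zeta>2 by linarith
  then have "(\<sigma> * sqrt (r / \<sigma>) + 2 * (b * p * min \<gamma> 1)) / \<sigma> \<le> 2 / 3 * \<zeta>\<^sub>2"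
    using pos(1) by (simp add: pos_divide_le_eq mult.commute)
  then show ?thesis
    using pos(1) by (simp add: add_divide_distrib r_def b_def p_def mult_ac)
qed

theorem lemma7:
  fixes A :: "real^'n^'n" and B :: "real^'m^'n" and C :: "real^'n^'d"
    and Q :: "real^'n^'n" and R :: "real^'m^'m"
    and D :: "(real^'n) measure"
    and J :: "real^'d^'m \<Rightarrow> real"
    and Kstar K K' :: "real^'d^'m"
    and \<mu> \<alpha> \<gamma> \<psi> \<zeta>\<^sub>1 \<zeta>\<^sub>2 \<zeta>\<^sub>3 \<zeta>\<^sub>4 M :: real
  assumes controllable: "controllable A B"
    and observable: "observable C A"
    and C_rows: "independent_rows C"
    and Q: "sym_pos_def Q"
    and R: "sym_pos_def R"
    and D: "prob_space D" "sets D = sets borel"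
    and X0: "sym_pos_def (second_moment D)"
    and \<mu>: "\<mu> = sigma_min (second_moment D)"
    and nonempty: "stabilizing A B C \<noteq> {}"
    and J: "J = sof_cost A B C Q R D"
    and Kstar: "Kstar \<in> stabilizing A B C" "\<forall>L \<in> stabilizing A B C. J Kstar \<le> J L"
    and \<alpha>: "J Kstar \<le> \<alpha>"
    and \<gamma>: "\<gamma> = (SUP L \<in> sof_sublevel A B C Q R D \<alpha>. norm2 (closed_loop A B C L))"
    and \<psi>: "\<psi> = sqrt (norm2 R * \<alpha> + (norm2 B)\<^sup>2 * \<alpha>\<^sup>2 / \<mu>) / (sqrt \<mu> * sigma_min R)
               + norm2 B * norm2 A * \<alpha> / (\<mu> * sigma_min R)"
    and \<zeta>\<^sub>1: "\<zeta>\<^sub>1 = 1 / sigma_min Q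
               * (\<alpha> / \<mu> * (1 + (norm2 B)\<^sup>2 * (norm2 C)\<^sup>2) + norm2 R * (norm2 C)\<^sup>2) - 1"
    and \<zeta>\<^sub>2: "\<zeta>\<^sub>2 = 2 * norm2 C / sigma_min Q
               * (\<alpha> * \<gamma> / \<mu> * norm2 B + \<psi> * norm2 R)"
    and \<zeta>\<^sub>3: "\<zeta>\<^sub>3 = 2 * norm2 C / sigma_min Q
               * (\<alpha> / \<mu> * (\<zeta>\<^sub>1 * \<gamma> + \<zeta>\<^sub>2 * \<gamma> + norm2 B * norm2 C) * norm2 B
                  + norm2 R * norm2 C)"
    and \<zeta>\<^sub>4: "\<zeta>\<^sub>4 = 2 * norm2 C / sigma_min Q
               * (\<alpha> / \<mu> * (\<zeta>\<^sub>1 * \<gamma> + norm2 B * norm2 C) * norm2 B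
                  + norm2 R * norm2 C)"
    and M: "M = 4 * \<alpha>\<^sup>2 * sqrt (real CARD('m) * real CARD('d)) / (\<mu> * sigma_min Q)
               * ((\<zeta>\<^sub>1 + \<zeta>\<^sub>2 / 2) * norm2 B * norm2 C + \<zeta>\<^sub>3 + \<zeta>\<^sub>4 / 2)
               * norm2 B * norm2 C"
    and K: "K \<in> sof_sublevel A B C Q R D \<alpha>"
    and K': "K' \<in> sof_sublevel A B C Q R D \<alpha>"
    and segment: "\<forall>\<delta> \<in> {0..1}. (1 - \<delta>) *\<^sub>R K + \<delta> *\<^sub>R K' \<in> sof_sublevel A B C Q R D \<alpha>"
  shows "frobenius_norm (hessian (\<lambda>v. J (unvectorize v)) (vectorize K')
            - hessian (\<lambda>v. J (unvectorize v)) (vectorize K))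
         \<le> M * frobenius_norm (K' - K)"
proof -
  interpret sof A B C Q R
    using Q R by unfold_locales
  define p where "p = \<alpha> / \<mu>"
  define \<sigma> where "\<sigma> = sigma_min Q"
  define b where "b = norm2 B * norm2 C"
  define r where "r = norm2 R * (norm2 C)\<^sup>2"
  define U where "U = min \<zeta>\<^sub>1 (2 / 3 * \<zeta>\<^sub>2)"
  define U2 where "U2 = (2 * (r + b\<^sup>2 * p) + 4 * b * p * \<gamma> * U) / \<sigma>"
  define U3 where "U3 = (6 * b * p * U2 + 6 * b\<^sup>2 * p * U) / \<sigma>"
  define X where "X = (\<zeta>\<^sub>1 + \<zeta>\<^sub>2 / 2) * b + \<zeta>\<^sub>3 + \<zeta>\<^sub>4 / 2"
  have pos: "0 < \<mu>" "0 < \<sigma>" "0 < sigma_min R"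
    unfolding \<mu> \<sigma>_def by (rule sigma_min_pos X0 Q R)+
  have b: "0 \<le> b" and r: "0 \<le> r"
    by (simp_all add: b_def r_def norm2_nonneg)
  note stable = sublevel_schur_stable
  have P_le: "x \<bullet> (P L *v x) \<le> p * (norm x)\<^sup>2" if "L \<in> sof_sublevel A B C Q R D \<alpha>" for L x
    using sublevel_P_le[OF X0 that] by (simp add: p_def \<mu>)
  have \<gamma>_ge: "norm2 (cl L) \<le> \<gamma>" if "L \<in> sof_sublevel A B C Q R D \<alpha>" for L
    unfolding \<gamma> by (rule sublevel_norm2_cl_le_SUP[OF X0 that])
  have \<gamma>_nonneg: "0 \<le> \<gamma>"
    using norm2_nonneg \<gamma>_ge[OF K] by (rule order_trans)
  have \<sigma>_le: "\<sigma> \<le> p"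
    unfolding \<sigma>_def by (rule sigma_le_p[OF stable[OF K] P_le[OF K] \<gamma>_ge[OF K]])
  then have p: "0 < p" using pos by simp
  then have \<alpha>_pos: "0 < \<alpha>"
    using pos by (simp add: p_def zero_less_divide_iff)
  have \<zeta>1: "\<zeta>\<^sub>1 = (p - \<sigma> + r + b\<^sup>2 * p) / \<sigma>"
    using pos(2) by (simp add: \<zeta>\<^sub>1 p_def[symmetric] \<sigma>_def[symmetric] r_def b_def power_mult_distrib field_simps)
  have "sigma_min R \<le> norm2 R"
  proof -
    obtain e :: "real^'m" where "norm e = 1"
      using norm_axis_1 by blast
    then show ?thesis
      using sigma_min_le_form[OF R, of e] abs_form_le_norm2[of e R e] by simp
  qed
  from P1_constant_le_zeta2[OF pos(2,1,3) this norm2_nonneg[of A] norm2_nonneg[of B] norm2_nonneg[of C]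
      \<gamma>_nonneg \<sigma>_le[unfolded p_def]]
  have \<zeta>2: "sqrt (r / \<sigma>) + 2 * b * p * min \<gamma> 1 / \<sigma> \<le> 2 / 3 * \<zeta>\<^sub>2"
    unfolding \<zeta>\<^sub>2 \<psi> r_def b_def p_def \<sigma>_def .
  have "0 \<le> \<zeta>\<^sub>1"
    unfolding \<zeta>1 using \<sigma>_le p r pos(2) by simp
  moreover have \<zeta>2_nonneg: "0 \<le> 2 / 3 * \<zeta>\<^sub>2"
    using r b p pos(2) \<gamma>_nonneg by (intro order_trans[OF _ \<zeta>2] add_nonneg_nonneg) simp_all
  ultimately have U: "0 \<le> U" "U \<le> \<zeta>\<^sub>1" "3 * U \<le> 2 * \<zeta>\<^sub>2"
    by (simp_all add: U_def)
  have U2: "0 \<le> U2"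
    unfolding U2_def using r b p U \<gamma>_nonneg pos(2) by simp
  have P1_le: "\<bar>x \<bullet> (P1 L Z *v x)\<bar> \<le> U * norm Z * (x \<bullet> (P L *v x))"
    if L: "L \<in> sof_sublevel A B C Q R D \<alpha>" for L Z x
  proof (cases "\<zeta>\<^sub>1 \<le> 2 / 3 * \<zeta>\<^sub>2")
    case True
    then have "U = (p - \<sigma> + r + b\<^sup>2 * p) / \<sigma>"
      by (simp only: U_def min_def if_True \<zeta>1)
    then show ?thesis
      using P1_le_zeta1[OF stable[OF L] P_le[OF L] \<gamma>_ge[OF L], of x Z]
      by (simp only: r_def b_def \<sigma>_def)
  next
    case False
    then have "(sqrt (r / \<sigma>) + 2 * b * p * min \<gamma> 1 / \<sigma>) * norm Z * (x \<bullet> (P L *v x))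
        \<le> U * norm Z * (x \<bullet> (P L *v x))"
      using \<zeta>2 P_nonneg[OF stable[OF L]] by (intro mult_right_mono) (simp_all add: U_def)
    then show ?thesis
      using P1_le_zeta2[OF stable[OF L] P_le[OF L] \<gamma>_ge[OF L], of x Z]
      unfolding r_def b_def \<sigma>_def by (rule order_trans[rotated])
  qed
  have P2_le: "\<bar>x \<bullet> (P2 L Z W *v x)\<bar> \<le> U2 * (norm Z * norm W) * (x \<bullet> (P L *v x))"
    if L: "L \<in> sof_sublevel A B C Q R D \<alpha>" for L Z W x
    using P2_le[OF stable[OF L] P_le[OF L] \<gamma>_ge[OF L] U(1) P1_le[OF L], of x Z W]
    unfolding U2_def r_def b_def \<sigma>_def .
  have P3_le: "\<bar>x \<bullet> (P3 L Z W V *v x)\<bar> \<le> U3 * (norm Z * norm W * norm V) * (x \<bullet> (P L *v x))"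
    if L: "L \<in> sof_sublevel A B C Q R D \<alpha>" for L Z W V x
    using P3_le[OF stable[OF L] P_le[OF L] \<gamma>_ge[OF L] U(1) P1_le[OF L] U2 P2_le[OF L], of x Z W V]
    unfolding U3_def b_def \<sigma>_def .
  have U3: "0 \<le> U3"
    unfolding U3_def using b p U(1) U2 pos(2) by simp
  have "closed_segment K K' \<subseteq> sof_sublevel A B C Q R D \<alpha>"
    using segment by (auto simp: closed_segment_def)
  from hessian_lipschitz[OF X0 U3 this P3_le]
  have "frobenius_norm (hessian (\<lambda>v. J (unvectorize v)) (vectorize K')
      - hessian (\<lambda>v. J (unvectorize v)) (vectorize K))
    \<le> sqrt (real CARD('d \<times> 'm)) * (U3 * \<alpha> * norm (K' - K))"
    unfolding J .
  also have "\<dots> \<le> sqrt (real CARD('d \<times> 'm)) * (4 * \<alpha> * p * b / \<sigma> * X * norm (K' - K))"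
  proof (intro mult_left_mono mult_right_mono)
    define T where "T = b * p * \<gamma>"
    have T: "0 \<le> T" using b p \<gamma>_nonneg by (simp add: T_def)
    \<comment> \<open>In 6 U2 against 4 \<open>\<zeta>\<^sub>3\<close> + 2
      \<open>\<zeta>\<^sub>4\<close> the terms without T agree, and 24 T U is paid as 12 T U \<le>
      12 T \<open>\<zeta>\<^sub>1\<close> plus 4 T (3 U) \<le> 4 T (2
      \<open>\<zeta>\<^sub>2\<close>).\<close>
    have "\<sigma> * \<zeta>\<^sub>3 = 2 * T * (\<zeta>\<^sub>1 + \<zeta>\<^sub>2) + 2 * (r + b\<^sup>2 * p)"
      "\<sigma> * \<zeta>\<^sub>4 = 2 * T * \<zeta>\<^sub>1 + 2 * (r + b\<^sup>2 * p)"
      using pos(2)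
      by (simp_all add: \<zeta>\<^sub>3 \<zeta>\<^sub>4 \<sigma>_def[symmetric] p_def[symmetric] T_def b_def r_def power2_eq_square algebra_simps)
    moreover have "T * U \<le> T * \<zeta>\<^sub>1" "T * (3 * U) \<le> T * (2 * \<zeta>\<^sub>2)"
      using U T by (intro mult_left_mono; simp)+
    moreover have "\<sigma> * U2 = 2 * (r + b\<^sup>2 * p) + 4 * T * U"
      using pos(2) by (simp add: U2_def T_def)
    ultimately have "\<sigma> * (6 * U2) \<le> \<sigma> * (4 * \<zeta>\<^sub>3 + 2 * \<zeta>\<^sub>4)"
      by (simp add: algebra_simps)
    then have "6 * U2 \<le> 4 * \<zeta>\<^sub>3 + 2 * \<zeta>\<^sub>4"
      using pos(2) by simp
    \<comment> \<open>Four copies of U go to \<open>\<zeta>\<^sub>1\<close>; the other two are at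
      most 4/3 \<open>\<zeta>\<^sub>2\<close>, and \<open>\<zeta>\<^sub>2\<close> is
      nonnegative.\<close>
    moreover have "b * (6 * U) \<le> b * (4 * \<zeta>\<^sub>1 + 2 * \<zeta>\<^sub>2)"
      using U b \<zeta>2_nonneg by (intro mult_left_mono) simp_all
    ultimately have "6 * U2 + 6 * b * U \<le> 4 * X"
      by (simp add: X_def algebra_simps)
    then have "b * p * \<alpha> / \<sigma> * (6 * U2 + 6 * b * U) \<le> b * p * \<alpha> / \<sigma> * (4 * X)"
      using b p \<alpha>_pos pos(2) by (intro mult_left_mono) simp_all
    then show "U3 * \<alpha> \<le> 4 * \<alpha> * p * b / \<sigma> * X"
      by (simp add: U3_def power2_eq_square algebra_simps add_divide_distrib)
  qed simp_all
  also have "\<dots> = M * frobenius_norm (K' - K)"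
    unfolding M X_def b_def p_def \<sigma>_def frobenius_norm_eq_norm
    by (simp add: power2_eq_square real_sqrt_mult mult_ac)
  finally show ?thesis .
qed

end
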